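(* Let $w$ and $\gamma$ be as in the context. For each $n\ge0$ let $\{P_{k,n}^{(\gamma)}:0\le k\le n\}$ be an orthonormal basis of $\mathcal{V}_n(W_\gamma)$, and let $\{P_{k,n}^{(\gamma),i,j}:0\le k\le n\}$ be an orthonormal basis of $\mathcal{V}_n(W_\gamma^{(i,j)})$ for $(i,j)=(1,1),(1,0),(0,1)$. Then for $n=0,1,\ldots$, an orthonormal basis of $\mathcal{V}_{2n}(\mathcal{W}_\gamma)$ is given by $${}_1Q_{k,2n}^{(\gamma)}(x,y)=P_{k,n}^{(\gamma)}(2xy,x^2+y^2-1),\quad 0\le k\le n,$$ $${}_2Q_{k,2n}^{(\gamma)}(x,y)=b_\gamma^{(1,1)}(x^2-y^2)\,P_{k,n-1}^{(\gamma),1,1}(2xy,x^2+y^2-1),\quad 0\le k\le n-1,$$ and an orthonormal basis of $\mathcal{V}_{2n+1}(\mathcal{W}_\gamma)$ is given by $${}_1Q_{k,2n+1}^{(\gamma)}(x,y)=b_\gamma^{(0,1)}(x+y)\,P_{k,n}^{(\gamma),0,1}(2xy,x^2+y^2-1),\quad 0\le k\le n,$$ $${}_2Q_{k,2n+1}^{(\gamma)}(x,y)=b_\gamma^{(1,0)}(x-y)\,P_{k,n}^{(\gamma),1,0}(2xy,x^2+y^2-1),\quad 0\le k\le n,$$ where $b_\gamma^{(i,j)}=\sqrt{a^\gamma_{w^{(i,j)}}/a^\gamma_w}$.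
   Context: For a nonnegative weight function $w$ on $[-1,1]$ and $\gamma>-1$ with $0<\int_{[-1,1]^2}w(x)w(y)|x-y|^{2\gamma+1}dx\,dy<\infty$, let $a_w^\gamma$ be the reciprocal of this integral. Let $\Omega=\{(u,v):1+u+v>0,\;1-u+v>0,\;u^2>4v\}$, the bijective image of $\{-1<s<t<1\}$ under $(s,t)\mapsto(s+t,st)$, and $$W_\gamma(u,v)=2a_w^\gamma w(s)w(t)(u^2-4v)^\gamma,\qquad u=s+t,\;v=st,\;(u,v)\in\Omega,$$ which has integral $1$ over $\Omega$. Define on $[-1,1]^2$ $$\mathcal{W}_\gamma(x,y)=W_\gamma(2xy,x^2+y^2-1)\,|x^2-y^2|.$$ For $i,j\in\{0,1\}$ let $w^{(i,j)}(x)=(1-x)^i(1+x)^jw(x)$ and let $$W_\gamma^{(i,j)}(u,v)=\frac{a_{w^{(i,j)}}^\gamma}{a_w^\gamma}(1-u+v)^i(1+u+v)^jW_\gamma(u,v),$$ which is the weight $W_\gamma$ built from $w^{(i,j)}$ in place of $w$ and has integral $1$ over $\Omega$. For a weight $W$ on a domain $D\subset\mathbb{R}^2$, $\langle f,g\rangle_W=\int_Df g\,W$; $\mathcal{V}_n(W)$ is the $(n+1)$-dimensional space of polynomials $P$ of total degree at most $n$ in two variables with $\langle P,Q\rangle_W=0$ for all polynomials $Q$ of total degree at most $n-1$. Orthonormality is with respect to $\langle\cdot,\cdot\rangle_W$.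
   Formalization: The domain Ω is taken with the extra condition |u|<2, since the three stated inequalities also hold at points such as (u,v)=(5,6), outside the image of {-1<s<t<1} where the weight is undefined; the corrected Ω is exactly that image. *)

theory Defs
  imports "HOL-Analysis.Analysis"
begin

text \<open>Polynomials are represented by the functions they induce on the plane.\<close>

definition polys2 :: "nat \<Rightarrow> (real \<times> real \<Rightarrow> real) set" where
  "polys2 n = {p. \<exists>c :: nat \<Rightarrow> nat \<Rightarrow> real. \<forall>x y.
     p (x, y) = (\<Sum>(i, j)\<in>{(i, j). i + j \<le> n}. c i j * x ^ i * y ^ j)}"

definition weighted_ip ::
  "(real \<times> real) set \<Rightarrow> (real \<times> real \<Rightarrow> real) \<Rightarrow>
   (real \<times> real \<Rightarrow> real) \<Rightarrow> (real \<times> real \<Rightarrow> real) \<Rightarrow> real" where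
  "weighted_ip D W f g = (LINT z:D|lebesgue. f z * g z * W z)"

text \<open>Quantifying over all degrees \<open>m < n\<close> expresses ``degree at most \<open>n - 1\<close>''
  without truncated subtraction: for \<open>n = 0\<close> there is no orthogonality condition.\<close>

definition orth_polys ::
  "(real \<times> real) set \<Rightarrow> (real \<times> real \<Rightarrow> real) \<Rightarrow> nat \<Rightarrow>
   (real \<times> real \<Rightarrow> real) set" where
  "orth_polys D W n =
     {P \<in> polys2 n. \<forall>m<n. \<forall>Q\<in>polys2 m. weighted_ip D W P Q = 0}"

definition onb_on ::
  "'k set \<Rightarrow> ('k \<Rightarrow> real \<times> real \<Rightarrow> real) \<Rightarrow>
   (real \<times> real) set \<Rightarrow> (real \<times> real \<Rightarrow> real) \<Rightarrow>
   (real \<times> real \<Rightarrow> real) set \<Rightarrow> bool" where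
  "onb_on K B D W V \<longleftrightarrow>
     (\<forall>k\<in>K. B k \<in> V) \<and>
     (\<forall>f\<in>V. \<exists>c. \<forall>z. f z = (\<Sum>k\<in>K. c k * B k z)) \<and>
     (\<forall>c. (\<forall>z. (\<Sum>k\<in>K. c k * B k z) = 0) \<longrightarrow> (\<forall>k\<in>K. c k = 0)) \<and>
     (\<forall>k\<in>K. \<forall>l\<in>K. weighted_ip D W (B k) (B l) = (if k = l then 1 else 0))"


abbreviation square :: "(real \<times> real) set" where
  "square \<equiv> {-1..1} \<times> {-1..1}"

definition energy_density :: "(real \<Rightarrow> real) \<Rightarrow> real \<Rightarrow> real \<times> real \<Rightarrow> real" where
  "energy_density w \<gamma> = (\<lambda>(x, y). w x * w y * \<bar>x - y\<bar> powr (2 * \<gamma> + 1))"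

definition a_const :: "(real \<Rightarrow> real) \<Rightarrow> real \<Rightarrow> real" where
  "a_const w \<gamma> = 1 / (LINT z:square|lebesgue. energy_density w \<gamma> z)"

definition st_triangle :: "(real \<times> real) set" where
  "st_triangle = {(s, t). -1 < s \<and> s < t \<and> t < 1}"

definition sym_map :: "real \<times> real \<Rightarrow> real \<times> real" where
  "sym_map = (\<lambda>(s, t). (s + t, s * t))"

text \<open>The condition \<open>\<bar>u\<bar> < 2\<close> is needed: the other three inequalities also hold at
  \<open>(s + t, s * t)\<close> when \<open>1 < s < t\<close> or \<open>s < t < -1\<close>, and so describe, besides the image
  of the triangle, two unbounded components on which the weight has no meaning.\<close>

definition Omega :: "(real \<times> real) set" where
  "Omega = {(u, v). 1 + u + v > 0 \<and> 1 - u + v > 0 \<and> u\<^sup>2 > 4 * v \<and> \<bar>u\<bar> < 2}"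

lemma bij_betw_sym_map: "bij_betw sym_map st_triangle Omega"
proof -
  define s where "s u v = (u - sqrt (u\<^sup>2 - 4 * v)) / 2" for u v :: real
  define t where "t u v = (u + sqrt (u\<^sup>2 - 4 * v)) / 2" for u v :: real
  have roots: "s (a + b) (a * b) = a \<and> t (a + b) (a * b) = b" if "a < b" for a b
  proof -
    have "(a + b)\<^sup>2 - 4 * (a * b) = (b - a)\<^sup>2"
      by (simp add: power2_eq_square algebra_simps)
    with that have "sqrt ((a + b)\<^sup>2 - 4 * (a * b)) = b - a" by simp
    then show ?thesis by (simp add: s_def t_def)
  qed
  have vieta: "s u v + t u v = u \<and> s u v * t u v = v" if "u\<^sup>2 > 4 * v" for u v
  proof -
    have "(sqrt (u\<^sup>2 - 4 * v))\<^sup>2 = u\<^sup>2 - 4 * v" using that by simp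
    moreover have "s u v * t u v = (u\<^sup>2 - (sqrt (u\<^sup>2 - 4 * v))\<^sup>2) / 4"
    proof -
      have "(a - r) / 2 * ((a + r) / 2) = (a\<^sup>2 - r\<^sup>2) / 4" for a r :: real
        by (simp add: power2_eq_square algebra_simps)
      then show ?thesis unfolding s_def t_def .
    qed
    moreover have "s u v + t u v = u"
      by (simp add: s_def t_def field_simps)
    ultimately show ?thesis by simp
  qed
  have in_Omega: "(a + b, a * b) \<in> Omega" if "-1 < a" "a < b" "b < 1" for a b
  proof -
    have "(1 + a) * (1 + b) > 0" "(1 - a) * (1 - b) > 0" "(b - a) * (b - a) > 0"
      using that by (auto intro!: mult_pos_pos)
    then have "1 + (a + b) + a * b > 0" "1 - (a + b) + a * b > 0" "(a + b)\<^sup>2 > 4 * (a * b)"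
      by (simp_all add: power2_eq_square algebra_simps)
    with that show ?thesis by (simp add: Omega_def abs_less_iff)
  qed
  have in_triangle: "(s u v, t u v) \<in> st_triangle" if "(u, v) \<in> Omega" for u v
  proof -
    have h: "0 < 1 + u + v" "0 < 1 - u + v" "4 * v < u\<^sup>2" "-2 < u" "u < 2"
      using that by (auto simp: Omega_def)
    have e: "(2 - u)\<^sup>2 = 4 - 4 * u + u\<^sup>2" "(2 + u)\<^sup>2 = 4 + 4 * u + u\<^sup>2"
      by (simp_all add: power2_eq_square algebra_simps)
    have "sqrt (u\<^sup>2 - 4 * v) < 2 - u" "sqrt (u\<^sup>2 - 4 * v) < 2 + u"
      using h e by (intro real_less_lsqrt; linarith)+
    moreover have "sqrt (u\<^sup>2 - 4 * v) > 0" using h by simp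
    ultimately show ?thesis by (simp add: st_triangle_def s_def t_def)
  qed
  show ?thesis
  proof (rule bij_betw_byWitness[where f' = "\<lambda>(u, v). (s u v, t u v)"])
    show "\<forall>p\<in>st_triangle. (\<lambda>(u, v). (s u v, t u v)) (sym_map p) = p"
      using roots by (auto simp: st_triangle_def sym_map_def)
    show "\<forall>p\<in>Omega. sym_map ((\<lambda>(u, v). (s u v, t u v)) p) = p"
      using vieta by (auto simp: Omega_def sym_map_def)
    show "sym_map ` st_triangle \<subseteq> Omega"
      using in_Omega by (auto simp: st_triangle_def sym_map_def)
    show "(\<lambda>(u, v). (s u v, t u v)) ` Omega \<subseteq> st_triangle"
      using in_triangle by auto
  qed
qed

text \<open>Off \<open>Omega\<close> the weight is set to zero; this affects \<open>calW\<close> only on the null set of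
  points of the square that \<open>(2xy, x\<^sup>2 + y\<^sup>2 - 1)\<close> sends to the boundary of \<open>Omega\<close>.\<close>

definition W_weight :: "(real \<Rightarrow> real) \<Rightarrow> real \<Rightarrow> real \<times> real \<Rightarrow> real" where
  "W_weight w \<gamma> = (\<lambda>(u, v).
     if (u, v) \<in> Omega then
       (case the_inv_into st_triangle sym_map (u, v) of (s, t) \<Rightarrow>
          2 * a_const w \<gamma> * w s * w t * (u\<^sup>2 - 4 * v) powr \<gamma>)
     else 0)"

lemma W_weight_sym:
  assumes "-1 < s" "s < t" "t < 1"
  shows "W_weight w \<gamma> (s + t, s * t) =
    2 * a_const w \<gamma> * w s * w t * ((s + t)\<^sup>2 - 4 * (s * t)) powr \<gamma>"
proof -
  have st: "(s, t) \<in> st_triangle" "sym_map (s, t) = (s + t, s * t)"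
    using assms by (auto simp: st_triangle_def sym_map_def)
  have "the_inv_into st_triangle sym_map (s + t, s * t) = (s, t)"
    using the_inv_into_f_f[OF bij_betw_imp_inj_on[OF bij_betw_sym_map] st(1)] st(2) by simp
  moreover have "(s + t, s * t) \<in> Omega"
    using bij_betwE[OF bij_betw_sym_map] st by force
  ultimately show ?thesis by (simp add: W_weight_def)
qed

definition calW :: "(real \<Rightarrow> real) \<Rightarrow> real \<Rightarrow> real \<times> real \<Rightarrow> real" where
  "calW w \<gamma> = (\<lambda>(x, y). W_weight w \<gamma> (2 * x * y, x\<^sup>2 + y\<^sup>2 - 1) * \<bar>x\<^sup>2 - y\<^sup>2\<bar>)"

definition w_mod :: "(real \<Rightarrow> real) \<Rightarrow> nat \<Rightarrow> nat \<Rightarrow> real \<Rightarrow> real" where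
  "w_mod w i j = (\<lambda>x. (1 - x) ^ i * (1 + x) ^ j * w x)"

definition W_mod :: "(real \<Rightarrow> real) \<Rightarrow> real \<Rightarrow> nat \<Rightarrow> nat \<Rightarrow> real \<times> real \<Rightarrow> real" where
  "W_mod w \<gamma> i j = (\<lambda>(u, v). a_const (w_mod w i j) \<gamma> / a_const w \<gamma>
     * (1 - u + v) ^ i * (1 + u + v) ^ j * W_weight w \<gamma> (u, v))"

lemma W_mod_eq_W_weight:
  assumes "a_const w \<gamma> \<noteq> 0"
  shows "W_mod w \<gamma> i j z = W_weight (w_mod w i j) \<gamma> z"
proof (cases "z \<in> Omega")
  case False
  then show ?thesis by (auto simp: W_mod_def W_weight_def split: prod.splits)
next
  case True
  then have "z \<in> sym_map ` st_triangle"
    using bij_betw_imp_surj_on[OF bij_betw_sym_map] by simp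
  then obtain s t where st: "-1 < s" "s < t" "t < 1" "z = (s + t, s * t)"
    by (auto simp: st_triangle_def sym_map_def)
  have e: "1 - (s + t) + s * t = (1 - s) * (1 - t)" "1 + (s + t) + s * t = (1 + s) * (1 + t)"
    by (simp_all add: algebra_simps)
  show ?thesis
    unfolding st(4) W_mod_def prod.case W_weight_sym[OF st(1-3)] e
    using assms by (simp add: w_mod_def power_mult_distrib)
qed

definition b_const :: "(real \<Rightarrow> real) \<Rightarrow> real \<Rightarrow> nat \<Rightarrow> nat \<Rightarrow> real" where
  "b_const w \<gamma> i j = sqrt (a_const (w_mod w i j) \<gamma> / a_const w \<gamma>)"

end

theory Submission
  imports Defs
begin

text \<open>Write \<open>u = 2xy\<close> and \<open>v = x\<^sup>2 + y\<^sup>2 - 1\<close>. The whole theorem rests on the two identities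
\<open>1 - u + v = (x - y)\<^sup>2\<close> and \<open>1 + u + v = (x + y)\<^sup>2\<close>.

Algebraically they say that every polynomial in \<open>x - y\<close> and \<open>x + y\<close>, that is, every polynomial in
\<open>x\<close> and \<open>y\<close>, splits according to the parities of the two exponents as
\<open>p = \<Sum>\<^sub>i\<^sub>,\<^sub>j (x - y)\<^sup>i (x + y)\<^sup>j f\<^sub>i\<^sub>j(u, v)\<close> with \<open>i, j \<in> {0, 1}\<close>, where the degree of \<open>f\<^sub>i\<^sub>j\<close> is at
most half of what \<open>(x - y)\<^sup>i (x + y)\<^sup>j\<close> leaves over (\<open>parity_split_below\<close>).

Analytically they say that the diagonals \<open>x = \<plusminus>y\<close> cut the square into four pieces, on each of which
\<open>(x, y) \<mapsto> (u, v)\<close> is a bijection onto \<open>Omega\<close> whose inverse is read off from the square roots of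
\<open>1 - u + v\<close> and \<open>1 + u + v\<close> with one choice of signs. The Jacobian is \<open>4 |x\<^sup>2 - y\<^sup>2|\<close>, which is
the extra factor in the weight \<open>calW\<close> times the number of pieces. Hence the integral of a function of \<open>(u, v)\<close>
against \<open>calW\<close> over the square is its integral over \<open>Omega\<close> against \<open>W_weight\<close>, and a factor
\<open>(x - y)\<^sup>i (x + y)\<^sup>j\<close> with an odd exponent makes the four contributions cancel
(\<open>chi_moment\<close>). So the four components of the splitting are mutually orthogonal, and on the component
\<open>(i, j)\<close> the inner product on the square is, up to the constant
\<open>r i j = a_const (w_mod w i j) \<gamma> / a_const w \<gamma>\<close>, that of \<open>W_mod w \<gamma> i j\<close> on \<open>Omega\<close>
(\<open>weighted_ip_chi\<close>).

Consequently a polynomial of degree \<open>N\<close> is orthogonal to all polynomials of lower degree iff each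
component is. For the components with \<open>i + j\<close> of the same parity as \<open>N\<close> this means that \<open>f\<^sub>i\<^sub>j\<close> is
an orthogonal polynomial of degree \<open>(N - i - j) / 2\<close>; for the other two it means that \<open>f\<^sub>i\<^sub>j\<close> is
orthogonal to every polynomial of its own degree, hence zero
(\<open>orthogonal_to_own_degree_imp_zero\<close>). The orthonormal bases on \<open>Omega\<close> therefore lift
to one on the square (\<open>lifted_onb\<close>), and the theorem consists of its even and odd cases.\<close>

section \<open>Change of variables in the plane\<close>

text \<open>The change-of-variables theorem is about spaces \<open>real ^ 'n\<close>. These two mutually inverse maps carry
it over to pairs of reals.\<close>

definition vec_of :: "real \<times> real \<Rightarrow> real^2" where "vec_of z = vector [fst z, snd z]"
definition pair_of :: "real^2 \<Rightarrow> real \<times> real" where "pair_of v = (v $ 1, v $ 2)"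

lemma pair_of_vec_of [simp]: "pair_of (vec_of z) = z"
  by (simp add: vec_of_def pair_of_def)

lemma vec_of_pair_of [simp]: "vec_of (pair_of v) = v"
  by (simp add: vec_of_def pair_of_def vec_eq_iff forall_2)

lemma bounded_linear_vec_of: "bounded_linear vec_of"
  by (rule linear_conv_bounded_linear[THEN iffD1], rule linearI)
     (auto simp: vec_of_def vec_eq_iff forall_2)

lemma bounded_linear_pair_of: "bounded_linear pair_of"
  by (rule linear_conv_bounded_linear[THEN iffD1], rule linearI)
     (auto simp: pair_of_def)

lemma vec_of_image: "vec_of ` S = pair_of -` S"
  by (auto simp: image_iff) (metis vec_of_pair_of)

lemma vec_of_image_cbox: "vec_of ` cbox (a, b) (c, d) = cbox (vec_of (a, b)) (vec_of (c, d))"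
  unfolding vec_of_image by (auto simp: mem_box_cart forall_2 pair_of_def vec_of_def cbox_Pair_eq)

lemma pair_of_image_cbox: "pair_of ` cbox u v = cbox (pair_of u) (pair_of v)"
proof -
  have "cbox u v = vec_of ` cbox (pair_of u) (pair_of v)"
    by (metis pair_of_def vec_of_image_cbox vec_of_pair_of)
  then show ?thesis by (simp add: image_comp o_def)
qed

lemma content_vec_of_image: "measure lborel (vec_of ` cbox a b) = measure lborel (cbox a b)"
proof (cases "cbox a b = {}")
  case False
  obtain a1 a2 b1 b2 where ab: "a = (a1, a2)" "b = (b1, b2)" by fastforce
  then have le: "a1 \<le> b1" "a2 \<le> b2" using False by (auto simp: cbox_Pair_eq)
  have "vec_of ` cbox a b \<noteq> {}" using False by simp
  then show ?thesis
    using le unfolding ab vec_of_image_cbox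
    by (simp add: content_cbox_cart content_Pair UNIV_2 vec_of_def)
qed simp

lemma content_pair_of_image: "measure lborel (pair_of ` cbox u v) = measure lborel (cbox u v)"
proof -
  have "vec_of ` pair_of ` cbox u v = cbox u v" by (simp add: image_comp o_def)
  moreover have "measure lborel (vec_of ` pair_of ` cbox u v) = measure lborel (pair_of ` cbox u v)"
    by (metis pair_of_image_cbox content_vec_of_image)
  ultimately show ?thesis by simp
qed

text \<open>The identification maps boxes to boxes of the same content. Boundedness of \<open>S\<close> allows the integral over
\<open>S\<close> to be taken over one box, after extending the integrand by zero.\<close>

lemma has_integral_vec_of_image:
  fixes f :: "real \<times> real \<Rightarrow> real"
  assumes "bounded S"
  shows "((\<lambda>v. f (pair_of v)) has_integral r) (vec_of ` S) \<longleftrightarrow> (f has_integral r) S"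
proof -
  obtain a b where S: "S \<subseteq> cbox a b" using assms bounded_subset_cbox_symmetric by metis
  let ?f = "\<lambda>z. if z \<in> S then f z else 0"
  have S': "vec_of ` S \<subseteq> vec_of ` cbox a b" using S by blast
  have e: "(\<lambda>v. if v \<in> vec_of ` S then f (pair_of v) else 0) = (\<lambda>v. ?f (pair_of v))"
    by (auto simp: vec_of_image fun_eq_iff)
  have cont: "continuous (at x) pair_of" "continuous (at y) vec_of" for x y
    using bounded_linear_pair_of bounded_linear_vec_of linear_continuous_at by blast+
  have box: "\<exists>w z. vec_of ` cbox u v = cbox w z" "\<exists>w z. pair_of ` cbox u' v' = cbox w z" for u v u' v'
    by (metis vec_of_image_cbox surj_pair, metis pair_of_image_cbox)
  obtain a' b' where ab': "vec_of ` cbox a b = cbox a' b'" using box by metis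
  have ab: "pair_of ` cbox a' b' = cbox a b" unfolding ab'[symmetric] by (simp add: image_comp o_def)
  have "((\<lambda>v. ?f (pair_of v)) has_integral r) (cbox a' b')" if "(?f has_integral r) (cbox a b)"
    using has_integral_twiddle[of 1 vec_of pair_of ?f r a b] that cont box ab'
    by (simp add: content_pair_of_image)
  moreover have "(?f has_integral r) (cbox a b)" if "((\<lambda>v. ?f (pair_of v)) has_integral r) (cbox a' b')"
    using has_integral_twiddle[OF zero_less_one pair_of_vec_of vec_of_pair_of cont(2) box(1) box(2), of "\<lambda>v. ?f (pair_of v)" r a' b'] that
    by (simp only: content_vec_of_image ab pair_of_vec_of mult_1 div_by_1 scaleR_one refl simp_thms)
  ultimately show ?thesis
    using has_integral_restrict[OF S, of f r] has_integral_restrict[OF S', of "\<lambda>v. f (pair_of v)" r]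
    unfolding e ab' by blast
qed

lemma absolutely_integrable_vec_of_image:
  fixes f :: "real \<times> real \<Rightarrow> real"
  assumes "bounded S"
  shows "(\<lambda>v. f (pair_of v)) absolutely_integrable_on (vec_of ` S) \<longleftrightarrow> f absolutely_integrable_on S"
  unfolding absolutely_integrable_on_def integrable_on_def
  using has_integral_vec_of_image[OF assms, of f] has_integral_vec_of_image[OF assms, of "\<lambda>x. norm (f x)"] by simp

lemma integral_vec_of_image:
  fixes f :: "real \<times> real \<Rightarrow> real"
  assumes "bounded S"
  shows "integral (vec_of ` S) (\<lambda>v. f (pair_of v)) = integral S f"
  by (simp add: integral_def integrable_on_def has_integral_vec_of_image[OF assms])

text \<open>The theorem for vector-valued integrands, applied to vectors of length one.\<close>

lemma vec_change_of_variables: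
  fixes f :: "real^'m::{finite,wellorder} \<Rightarrow> real" and g :: "real^'m::_ \<Rightarrow> real^'m::_"
  assumes S: "S \<in> sets lebesgue"
    and der_g: "\<And>x. x \<in> S \<Longrightarrow> (g has_derivative g' x) (at x within S)"
    and inj: "inj_on g S"
  shows "(\<lambda>x. \<bar>det (matrix (g' x))\<bar> * f(g x)) absolutely_integrable_on S \<and>
           integral S (\<lambda>x. \<bar>det (matrix (g' x))\<bar> * f(g x)) = b
     \<longleftrightarrow> f absolutely_integrable_on (g ` S) \<and> integral (g ` S) f = b"
proof -
  have "(\<lambda>x. \<bar>det (matrix (g' x))\<bar> *\<^sub>R vec (f(g x)) :: real^1) absolutely_integrable_on S \<and>
           integral S (\<lambda>x. \<bar>det (matrix (g' x))\<bar> *\<^sub>R vec (f(g x))) = (vec b :: real^1)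
     \<longleftrightarrow> (\<lambda>x. vec (f x) :: real^1) absolutely_integrable_on (g ` S) \<and> integral (g ` S) (\<lambda>x. vec (f x)) = (vec b :: real^1)"
    by (rule has_absolute_integral_change_of_variables [OF S der_g inj])
  then show ?thesis
    by (simp add: absolutely_integrable_on_1_iff integral_on_1_eq)
qed

text \<open>The functions \<open>a, b, c, d\<close> are the entries of the Jacobian matrix. The set and its image are bounded so
that integrals over both can be transferred between pairs and vectors.\<close>

proposition pair_change_of_variables:
  fixes f :: "real \<times> real \<Rightarrow> real" and F :: "real \<times> real \<Rightarrow> real \<times> real"
  assumes "open S" "bounded S" "bounded (F ` S)" and inj: "inj_on F S"
    and der: "\<And>z. z \<in> S \<Longrightarrow> (F has_derivative (\<lambda>(h, k). (a z * h + b z * k, c z * h + d z * k))) (at z)"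
  shows "(\<lambda>z. \<bar>a z * d z - b z * c z\<bar> * f (F z)) absolutely_integrable_on S \<and>
           integral S (\<lambda>z. \<bar>a z * d z - b z * c z\<bar> * f (F z)) = r
     \<longleftrightarrow> f absolutely_integrable_on (F ` S) \<and> integral (F ` S) f = r"
proof -
  let ?g = "\<lambda>v. vec_of (F (pair_of v))"
  let ?D = "\<lambda>v h. vec_of (a (pair_of v) * h $ 1 + b (pair_of v) * h $ 2,
    c (pair_of v) * h $ 1 + d (pair_of v) * h $ 2)"
  have op: "open (vec_of ` S)"
    unfolding vec_of_image
    by (rule open_vimage[OF assms(1)]) (simp add: bounded_linear_pair_of linear_continuous_on)
  have dg: "(?g has_derivative ?D v) (at v within vec_of ` S)" if "v \<in> vec_of ` S" for v
  proof -
    have "pair_of v \<in> S" using that by auto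
    from has_derivative_compose[OF bounded_linear_imp_has_derivative[OF bounded_linear_pair_of] der[OF this]]
    have "((\<lambda>v. F (pair_of v)) has_derivative (\<lambda>h. (a (pair_of v) * h $ 1 + b (pair_of v) * h $ 2,
        c (pair_of v) * h $ 1 + d (pair_of v) * h $ 2))) (at v)"
      by (simp add: pair_of_def)
    from bounded_linear.has_derivative[OF bounded_linear_vec_of this]
    show ?thesis by (simp add: has_derivative_at_withinI)
  qed
  have det: "det (matrix (?D v)) = a (pair_of v) * d (pair_of v) - b (pair_of v) * c (pair_of v)" for v
    by (simp add: det_2 matrix_def vec_of_def axis_def)
  have "inj_on ?g (vec_of ` S)"
    using inj unfolding inj_on_def by (metis (no_types, lifting) imageE pair_of_vec_of)
  from vec_change_of_variables[where f = "\<lambda>v. f (pair_of v)" and b = r, OF _ dg this] op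
  have "(\<lambda>v. \<bar>det (matrix (?D v))\<bar> * f (F (pair_of v))) absolutely_integrable_on vec_of ` S \<and>
      integral (vec_of ` S) (\<lambda>v. \<bar>det (matrix (?D v))\<bar> * f (F (pair_of v))) = r \<longleftrightarrow>
      (\<lambda>v. f (pair_of v)) absolutely_integrable_on vec_of ` F ` S \<and> integral (vec_of ` F ` S) (\<lambda>v. f (pair_of v)) = r"
    by (simp add: image_image lborelD)
  then show ?thesis
    unfolding det
      integral_vec_of_image[OF assms(2), of "\<lambda>z. \<bar>a z * d z - b z * c z\<bar> * f (F z)"]
      absolutely_integrable_vec_of_image[OF assms(2), of "\<lambda>z. \<bar>a z * d z - b z * c z\<bar> * f (F z)"]
      integral_vec_of_image[OF assms(3)] absolutely_integrable_vec_of_image[OF assms(3)] .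
qed

section \<open>Polynomials of bounded degree\<close>

text \<open>Bounding the degree strictly avoids truncated subtraction: ``degree below \<open>n\<close>'' is the condition in
the definition of orthogonal polynomials of degree \<open>n\<close>, and it forces \<open>p = 0\<close> when \<open>n = 0\<close>.\<close>

definition polys_below :: "nat \<Rightarrow> (real \<times> real \<Rightarrow> real) set" where
  "polys_below m = {p. \<exists>c :: nat \<Rightarrow> nat \<Rightarrow> real. \<forall>x y.
     p (x, y) = (\<Sum>(i, j)\<in>{(i, j). i + j < m}. c i j * x ^ i * y ^ j)}"

lemma polys2_eq_below: "polys2 n = polys_below (Suc n)"
  by (simp add: polys2_def polys_below_def less_Suc_eq_le)

lemma finite_pairs_below: "finite {(i, j). i + j < (m::nat)}"
  by (rule finite_subset[of _ "{..<m} \<times> {..<m}"]) auto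

lemma polys_below_0: "p \<in> polys_below 0 \<longleftrightarrow> p = (\<lambda>z. 0)"
  by (auto simp: polys_below_def)

lemma polys_below_zero: "(\<lambda>z. 0) \<in> polys_below m"
  by (auto simp: polys_below_def intro!: exI[of _ "\<lambda>_ _. 0"])

lemma polys_below_add: "p \<in> polys_below m \<Longrightarrow> q \<in> polys_below m \<Longrightarrow> (\<lambda>z. p z + q z) \<in> polys_below m"
  unfolding polys_below_def mem_Collect_eq
proof (elim exE)
  fix c d :: "nat \<Rightarrow> nat \<Rightarrow> real"
  assume "\<forall>x y. p (x, y) = (\<Sum>(i, j)\<in>{(i, j). i + j < m}. c i j * x ^ i * y ^ j)"
    "\<forall>x y. q (x, y) = (\<Sum>(i, j)\<in>{(i, j). i + j < m}. d i j * x ^ i * y ^ j)"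
  then show "\<exists>c. \<forall>x y. p (x, y) + q (x, y) = (\<Sum>(i, j)\<in>{(i, j). i + j < m}. c i j * x ^ i * y ^ j)"
    by (intro exI[of _ "\<lambda>i j. c i j + d i j"])
      (simp add: sum.distrib[symmetric] distrib_right case_prod_beta)
qed

lemma polys_below_scale: "p \<in> polys_below m \<Longrightarrow> (\<lambda>z. a * p z) \<in> polys_below m"
  unfolding polys_below_def mem_Collect_eq
proof (elim exE)
  fix c :: "nat \<Rightarrow> nat \<Rightarrow> real"
  assume "\<forall>x y. p (x, y) = (\<Sum>(i, j)\<in>{(i, j). i + j < m}. c i j * x ^ i * y ^ j)"
  then show "\<exists>c. \<forall>x y. a * p (x, y) = (\<Sum>(i, j)\<in>{(i, j). i + j < m}. c i j * x ^ i * y ^ j)"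
    by (intro exI[of _ "\<lambda>i j. a * c i j"])
      (simp add: sum_distrib_left case_prod_beta mult.assoc)
qed

lemma polys_below_monomial:
  assumes "a + b < m"
  shows "(\<lambda>z. fst z ^ a * snd z ^ b) \<in> polys_below m"
proof -
  have "x ^ a * y ^ b = (\<Sum>(i, j)\<in>{(i, j). i + j < m}. (if i = a \<and> j = b then 1 else 0) * x ^ i * y ^ j)"
    for x y :: real
  proof -
    have "(\<Sum>(i, j)\<in>{(i, j). i + j < m}. (if i = a \<and> j = b then 1 else 0) * x ^ i * y ^ j) =
        (\<Sum>p\<in>{(i, j). i + j < m}. if p = (a, b) then x ^ a * y ^ b else 0)"
      by (rule sum.cong) (auto split: if_splits)
    also have "\<dots> = x ^ a * y ^ b"
      using assms finite_pairs_below[of m] by (simp add: sum.delta)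
    finally show ?thesis ..
  qed
  then show ?thesis by (auto simp: polys_below_def)
qed

lemma polys_below_induct [consumes 1, case_names zero add scale monomial]:
  assumes "p \<in> polys_below m" and zero: "Q (\<lambda>z. 0)"
    and add: "\<And>p q. Q p \<Longrightarrow> Q q \<Longrightarrow> Q (\<lambda>z. p z + q z)"
    and scale: "\<And>a p. Q p \<Longrightarrow> Q (\<lambda>z. a * p z)"
    and monomial: "\<And>i j. i + j < m \<Longrightarrow> Q (\<lambda>z. fst z ^ i * snd z ^ j)"
  shows "Q p"
proof -
  obtain c :: "nat \<Rightarrow> nat \<Rightarrow> real" where
    "\<And>x y. p (x, y) = (\<Sum>(i, j)\<in>{(i, j). i + j < m}. c i j * x ^ i * y ^ j)"
    using assms(1) by (auto simp: polys_below_def)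
  then have p: "p = (\<lambda>z. \<Sum>(i, j)\<in>{(i, j). i + j < m}. c i j * (fst z ^ i * snd z ^ j))"
    by (auto simp: mult.assoc)
  have "Q (\<lambda>z. \<Sum>(i, j)\<in>S. c i j * (fst z ^ i * snd z ^ j))"
    if "finite S" "S \<subseteq> {(i, j). i + j < m}" for S
    using that
  proof (induction S)
    case empty
    then show ?case by (simp add: zero)
  next
    case (insert s S)
    obtain i j where s: "s = (i, j)" "i + j < m" using insert.prems by auto
    show ?case
      using add[OF scale[OF monomial[OF s(2)], of "c i j"] insert.IH] insert.prems insert.hyps s
      by simp
  qed
  from this[OF finite_pairs_below subset_refl] show ?thesis unfolding p .
qed

lemma polys_below_mono: "p \<in> polys_below m \<Longrightarrow> m \<le> n \<Longrightarrow> p \<in> polys_below n"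
  by (induction rule: polys_below_induct) (auto intro: polys_below_zero polys_below_add polys_below_scale polys_below_monomial)

lemma continuous_below: "p \<in> polys_below m \<Longrightarrow> continuous_on S p"
  by (induction rule: polys_below_induct) (auto simp: case_prod_beta intro!: continuous_intros)

lemma polys_below_times_fst: "p \<in> polys_below m \<Longrightarrow> (\<lambda>z. fst z * p z) \<in> polys_below (Suc m)"
proof (induction rule: polys_below_induct)
  case (monomial i j)
  then show ?case
    using polys_below_monomial[of "Suc i" j "Suc m"] by (simp add: case_prod_beta mult.assoc)
next
  case (scale a p)
  then show ?case using polys_below_scale[OF scale, of a] by (simp add: mult.left_commute)
qed (auto simp: distrib_left intro: polys_below_zero polys_below_add)

lemma polys_below_times_snd: "p \<in> polys_below m \<Longrightarrow> (\<lambda>z. snd z * p z) \<in> polys_below (Suc m)"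
proof (induction rule: polys_below_induct)
  case (monomial i j)
  then show ?case
    using polys_below_monomial[of i "Suc j" "Suc m"] by (simp add: case_prod_beta mult.left_commute)
next
  case (scale a p)
  then show ?case using polys_below_scale[OF scale, of a] by (simp add: mult.left_commute)
qed (auto simp: distrib_left intro: polys_below_zero polys_below_add)

lemma polys_below_times_affine:
  assumes "p \<in> polys_below m"
  shows "(\<lambda>z. (a * fst z + b * snd z + c) * p z) \<in> polys_below (Suc m)"
  using polys_below_add[OF polys_below_add[OF polys_below_scale[OF polys_below_times_fst[OF assms], of a]
      polys_below_scale[OF polys_below_times_snd[OF assms], of b]] polys_below_scale[OF polys_below_mono[OF assms], of "Suc m" c]]
  by (simp add: algebra_simps)

section \<open>The quadratic map and the decomposition of polynomials by parity\<close>

definition lift_map :: "real \<times> real \<Rightarrow> real \<times> real" where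
  "lift_map = (\<lambda>(x, y). (2 * x * y, x\<^sup>2 + y\<^sup>2 - 1))"

text \<open>The four products with \<open>i, j \<in> {0, 1}\<close> represent the parity classes: \<open>chi i j\<close> is multiplied
by \<open>(-1) ^ i\<close> when \<open>x\<close> and \<open>y\<close> are exchanged, and by \<open>(-1) ^ (i + j)\<close> when both change sign.\<close>

definition chi :: "nat \<Rightarrow> nat \<Rightarrow> real \<times> real \<Rightarrow> real" where
  "chi i j = (\<lambda>(x, y). (x - y) ^ i * (x + y) ^ j)"

lemma fst_lift_map: "fst (lift_map z) = 2 * fst z * snd z"
  and snd_lift_map: "snd (lift_map z) = (fst z)\<^sup>2 + (snd z)\<^sup>2 - 1"
  by (simp_all add: lift_map_def case_prod_beta)

lemma polys_below_times_lift_map: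
  assumes "p \<in> polys_below m"
  shows "(\<lambda>z. fst (lift_map z) * p z) \<in> polys_below (m + 2)" "(\<lambda>z. snd (lift_map z) * p z) \<in> polys_below (m + 2)"
proof -
  have "(\<lambda>z. 2 * (fst z * (snd z * p z))) \<in> polys_below (m + 2)"
    using polys_below_scale[OF polys_below_times_fst[OF polys_below_times_snd[OF assms]], of 2] by simp
  then show "(\<lambda>z. fst (lift_map z) * p z) \<in> polys_below (m + 2)"
    by (simp add: lift_map_def case_prod_beta mult.assoc)
  have "(\<lambda>z. fst z * (fst z * p z) + snd z * (snd z * p z) + (-1) * p z) \<in> polys_below (m + 2)"
    using polys_below_add[OF polys_below_add[OF polys_below_times_fst[OF polys_below_times_fst[OF assms]]
       polys_below_times_snd[OF polys_below_times_snd[OF assms]]] polys_below_scale[OF polys_below_mono[OF assms], of _ "-1"]] by simp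
  then show "(\<lambda>z. snd (lift_map z) * p z) \<in> polys_below (m + 2)"
    by (simp add: lift_map_def case_prod_beta power2_eq_square algebra_simps)
qed

lemma polys_below_compose_lift_map: "p \<in> polys_below m \<Longrightarrow> (\<lambda>z. p (lift_map z)) \<in> polys_below (2 * m - 1)"
proof (induction rule: polys_below_induct)
  case (monomial i j)
  have j: "(\<lambda>z. snd (lift_map z) ^ j) \<in> polys_below (2 * j + 1)" for j
  proof (induction j)
    case 0
    show ?case using polys_below_monomial[of 0 0 1] by (simp add: case_prod_beta)
  next
    case (Suc j)
    show ?case using polys_below_times_lift_map(2)[OF Suc] by simp
  qed
  have "(\<lambda>z. fst (lift_map z) ^ i * snd (lift_map z) ^ j) \<in> polys_below (2 * (i + j) + 1)" for i
  proof (induction i)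
    case 0
    show ?case using j by simp
  next
    case (Suc i)
    show ?case using polys_below_times_lift_map(1)[OF Suc] by (simp add: mult.assoc)
  qed
  then show ?case
    using polys_below_mono[of _ "2 * (i + j) + 1" "2 * m - 1"] monomial by (simp add: case_prod_beta)
qed (auto intro: polys_below_zero polys_below_add polys_below_scale)

text \<open>Composition with \<open>lift_map\<close> doubles degrees. For \<open>m = 0\<close> the polynomial is zero, so the truncated
subtraction does no harm.\<close>

lemma polys_below_chi_compose_lift_map:
  assumes "p \<in> polys_below m"
  shows "(\<lambda>z. chi i j z * p (lift_map z)) \<in> polys_below (i + j + 2 * m - 1)"
proof (cases m)
  case 0
  then show ?thesis using assms by (simp add: polys_below_0 polys_below_zero)
next
  case (Suc m')
  have j: "(\<lambda>z. (fst z + snd z) ^ j * p (lift_map z)) \<in> polys_below (j + 2 * m - 1)" for j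
  proof (induction j)
    case 0
    show ?case using polys_below_compose_lift_map[OF assms] by simp
  next
    case (Suc j)
    show ?case using polys_below_times_affine[OF Suc, of 1 1 0] \<open>m = Suc m'\<close> by (simp add: mult.assoc)
  qed
  have "(\<lambda>z. (fst z - snd z) ^ i * ((fst z + snd z) ^ j * p (lift_map z))) \<in> polys_below (i + j + 2 * m - 1)" for i
  proof (induction i)
    case 0
    show ?case using j by simp
  next
    case (Suc i)
    show ?case using polys_below_times_affine[OF Suc, of 1 "-1" 0] \<open>m = Suc m'\<close> by (simp add: mult.assoc)
  qed
  then show ?thesis by (simp add: chi_def case_prod_beta mult.assoc)
qed

text \<open>The bound \<open>(m + 1 - i - j) div 2\<close> is what degree below \<open>m\<close> leaves for \<open>f i j\<close>: the product
\<open>chi i j * (f i j \<circ> lift_map)\<close> has degree \<open>i + j\<close> plus twice that of \<open>f i j\<close>.\<close>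

definition parity_split :: "nat \<Rightarrow> (real \<times> real \<Rightarrow> real) \<Rightarrow> bool" where
  "parity_split m p \<longleftrightarrow> (\<exists>f :: nat \<Rightarrow> nat \<Rightarrow> real \<times> real \<Rightarrow> real.
     (\<forall>i\<le>1. \<forall>j\<le>1. f i j \<in> polys_below ((m + 1 - i - j) div 2)) \<and>
     (\<forall>z. p z = (\<Sum>i\<le>1. \<Sum>j\<le>1. chi i j z * f i j (lift_map z))))"

lemma all_le_1: "(\<forall>i\<le>1. P (i::nat)) \<longleftrightarrow> P 0 \<and> P 1"
  using le_Suc_eq by auto

lemma sum_le_1: "(\<Sum>i\<le>1. g (i::nat)) = g 0 + (g 1 :: real)"
  by simp

lemma parity_split_add:
  assumes "parity_split m p" "parity_split m q"
  shows "parity_split m (\<lambda>z. p z + q z)"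
proof -
  from assms obtain f g where
    "\<forall>i\<le>1. \<forall>j\<le>1. f i j \<in> polys_below ((m + 1 - i - j) div 2)"
    "\<forall>z. p z = (\<Sum>i\<le>1. \<Sum>j\<le>1. chi i j z * f i j (lift_map z))"
    "\<forall>i\<le>1. \<forall>j\<le>1. g i j \<in> polys_below ((m + 1 - i - j) div 2)"
    "\<forall>z. q z = (\<Sum>i\<le>1. \<Sum>j\<le>1. chi i j z * g i j (lift_map z))"
    unfolding parity_split_def by blast
  then show ?thesis
    unfolding parity_split_def
    by (intro exI[of _ "\<lambda>i j z. f i j z + g i j z"])
      (simp add: polys_below_add distrib_left sum.distrib[symmetric] del: sum.atMost_Suc)
qed

lemma parity_split_scale:
  assumes "parity_split m p"
  shows "parity_split m (\<lambda>z. a * p z)"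
proof -
  from assms obtain f where
    "\<forall>i\<le>1. \<forall>j\<le>1. f i j \<in> polys_below ((m + 1 - i - j) div 2)"
    "\<forall>z. p z = (\<Sum>i\<le>1. \<Sum>j\<le>1. chi i j z * f i j (lift_map z))"
    unfolding parity_split_def by blast
  then show ?thesis
    unfolding parity_split_def
    by (intro exI[of _ "\<lambda>i j z. a * f i j z"])
      (simp add: polys_below_scale sum_distrib_left mult.left_commute del: sum.atMost_Suc)
qed

text \<open>Multiplication by \<open>x + y\<close> exchanges the classes \<open>j = 0\<close> and \<open>j = 1\<close>. Passing from \<open>1\<close> to \<open>0\<close> creates
\<open>(x + y)\<^sup>2\<close>, which equals \<open>1 + u + v\<close> and is absorbed in the coefficient.\<close>

lemma parity_split_times_sum:
  assumes "parity_split (Suc m) p"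
  shows "parity_split (Suc (Suc m)) (\<lambda>z. (fst z + snd z) * p z)"
proof -
  from assms obtain f where
    f: "\<forall>i\<le>1. \<forall>j\<le>1. f i j \<in> polys_below ((Suc m + 1 - i - j) div 2)"
      "\<forall>z. p z = (\<Sum>i\<le>1. \<Sum>j\<le>1. chi i j z * f i j (lift_map z))"
    unfolding parity_split_def by blast
  \<comment> \<open>At an image point \<open>(u, v)\<close> the affine factor is \<open>1 + u + v\<close>.\<close>
  define g where "g = (\<lambda>i j z. if j = (0::nat) then (1 * fst z + 1 * snd z + 1) * f i 1 z else f i 0 z)"
  have "g i j \<in> polys_below ((Suc (Suc m) + 1 - i - j) div 2)" if "i \<le> 1" "j \<le> 1" for i j
  proof (cases "j = 0")
    case True
    have "f i 1 \<in> polys_below ((Suc m + 1 - i - 1) div 2)" using f(1) that by blast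
    from polys_below_times_affine[OF this, of 1 1 1]
    have "g i j \<in> polys_below (Suc ((Suc m + 1 - i - 1) div 2))" using True by (simp add: g_def)
    moreover have "Suc ((Suc m + 1 - i - 1) div 2) = (Suc (Suc m) + 1 - i - j) div 2"
      using that(1) True by (cases "i = 0") auto
    ultimately show ?thesis by (simp only:)
  next
    case False
    then have j: "j = 1" using that by simp
    have "f i 0 \<in> polys_below ((Suc m + 1 - i - 0) div 2)" using f(1) that by blast
    moreover have "Suc m + 1 - i - 0 = Suc (Suc m) + 1 - i - 1" by simp
    ultimately show ?thesis unfolding j by (simp add: g_def)
  qed
  moreover have "(fst z + snd z) * p z = (\<Sum>i\<le>1. \<Sum>j\<le>1. chi i j z * g i j (lift_map z))" for z
    by (simp add: f(2) sum_le_1 g_def chi_def case_prod_beta fst_lift_map snd_lift_map del: sum.atMost_Suc)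
      (simp add: fst_lift_map snd_lift_map algebra_simps power2_eq_square)
  ultimately show ?thesis unfolding parity_split_def by blast
qed

text \<open>The same with \<open>x - y\<close>, the classes of \<open>i\<close>, and \<open>(x - y)\<^sup>2 = 1 - u + v\<close>.\<close>

lemma parity_split_times_diff:
  assumes "parity_split (Suc m) p"
  shows "parity_split (Suc (Suc m)) (\<lambda>z. (fst z - snd z) * p z)"
proof -
  from assms obtain f where
    f: "\<forall>i\<le>1. \<forall>j\<le>1. f i j \<in> polys_below ((Suc m + 1 - i - j) div 2)"
      "\<forall>z. p z = (\<Sum>i\<le>1. \<Sum>j\<le>1. chi i j z * f i j (lift_map z))"
    unfolding parity_split_def by blast
  \<comment> \<open>At an image point \<open>(u, v)\<close> the affine factor is \<open>1 - u + v\<close>.\<close>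
  define g where "g = (\<lambda>i j z. if i = (0::nat) then (-1 * fst z + 1 * snd z + 1) * f 1 j z else f 0 j z)"
  have "g i j \<in> polys_below ((Suc (Suc m) + 1 - i - j) div 2)" if "i \<le> 1" "j \<le> 1" for i j
  proof (cases "i = 0")
    case True
    have "f 1 j \<in> polys_below ((Suc m + 1 - 1 - j) div 2)" using f(1) that by blast
    from polys_below_times_affine[OF this, of "-1" 1 1]
    have "g i j \<in> polys_below (Suc ((Suc m + 1 - 1 - j) div 2))" using True by (simp add: g_def)
    moreover have "Suc ((Suc m + 1 - 1 - j) div 2) = (Suc (Suc m) + 1 - i - j) div 2"
      using that(2) True by (cases "j = 0") auto
    ultimately show ?thesis by (simp only:)
  next
    case False
    then have i: "i = 1" using that by simp
    have "f 0 j \<in> polys_below ((Suc m + 1 - 0 - j) div 2)" using f(1) that by blast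
    moreover have "Suc m + 1 - 0 - j = Suc (Suc m) + 1 - 1 - j" by simp
    ultimately show ?thesis unfolding i by (simp add: g_def)
  qed
  moreover have "(fst z - snd z) * p z = (\<Sum>i\<le>1. \<Sum>j\<le>1. chi i j z * g i j (lift_map z))" for z
    by (simp add: f(2) sum_le_1 g_def chi_def case_prod_beta fst_lift_map snd_lift_map del: sum.atMost_Suc)
      (simp add: fst_lift_map snd_lift_map algebra_simps power2_eq_square)
  ultimately show ?thesis unfolding parity_split_def by blast
qed

lemma parity_split_mono:
  assumes "parity_split m p" "m \<le> n"
  shows "parity_split n p"
proof -
  have "(m + 1 - i - j) div 2 \<le> (n + 1 - i - j) div 2" for i j
    using assms(2) by (intro div_le_mono diff_le_mono) simp
  with assms(1) polys_below_mono show ?thesis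
    unfolding parity_split_def by blast
qed

lemma parity_split_times_coordinate:
  assumes "parity_split (Suc m) p"
  shows "parity_split (Suc (Suc m)) (\<lambda>z. fst z * p z)" "parity_split (Suc (Suc m)) (\<lambda>z. snd z * p z)"
proof -
  have "fst z * p z = 1/2 * ((fst z + snd z) * p z) + 1/2 * ((fst z - snd z) * p z)"
    "snd z * p z = 1/2 * ((fst z + snd z) * p z) + (-1/2) * ((fst z - snd z) * p z)" for z
    by (simp_all add: field_simps)
  then show "parity_split (Suc (Suc m)) (\<lambda>z. fst z * p z)" "parity_split (Suc (Suc m)) (\<lambda>z. snd z * p z)"
    by (simp_all only: parity_split_add parity_split_scale parity_split_times_sum[OF assms] parity_split_times_diff[OF assms])
qed

lemma parity_split_monomial: "parity_split (Suc (a + b)) (\<lambda>z. fst z ^ a * snd z ^ b)"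
proof (induction a)
  case 0
  show ?case
  proof (induction b)
    case 0
    have "(\<lambda>z. 1) \<in> polys_below 1" using polys_below_monomial[of 0 0 1] by simp
    then show ?case
      unfolding parity_split_def all_le_1 sum_le_1
      by (intro exI[of _ "\<lambda>i j z. if i = 0 \<and> j = 0 then 1 else 0"])
        (simp add: polys_below_zero chi_def case_prod_beta)
  next
    case (Suc b)
    from parity_split_times_coordinate(2)[OF Suc] show ?case by simp
  qed
next
  case (Suc a)
  from parity_split_times_coordinate(1)[OF Suc] show ?case by (simp add: mult.assoc)
qed

text \<open>The class of polynomials that split contains the constants and is closed under multiplication by
\<open>x + y\<close> and \<open>x - y\<close>, hence by \<open>x\<close> and \<open>y\<close>, with the degree bound growing by one each time.\<close>

lemma parity_split_below: "p \<in> polys_below m \<Longrightarrow> parity_split m p"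
proof (induction rule: polys_below_induct)
  case zero
  show ?case
    unfolding parity_split_def by (rule exI[of _ "\<lambda>i j z. 0"]) (simp add: polys_below_zero)
next
  case (monomial i j)
  then show ?case using parity_split_mono[OF parity_split_monomial[of i j], of m] by simp
next
  case (add p q)
  then show ?case by (rule parity_split_add)
next
  case (scale a p)
  then show ?case by (rule parity_split_scale)
qed

section \<open>Integration over the square\<close>

text \<open>The factor is a quarter of the Jacobian determinant of \<open>lift_map\<close>, up to sign.\<close>

definition lift_weight :: "(real \<times> real \<Rightarrow> real) \<Rightarrow> real \<times> real \<Rightarrow> real" where
  "lift_weight W = (\<lambda>z. W (lift_map z) * \<bar>(fst z)\<^sup>2 - (snd z)\<^sup>2\<bar>)"

text \<open>For signs \<open>\<sigma>\<close> and \<open>\<tau>\<close> these are the four open triangles into which the diagonals cut the square.\<close>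

definition quarter :: "real \<Rightarrow> real \<Rightarrow> (real \<times> real) set" where
  "quarter \<sigma> \<tau> = {(x, y). \<bar>x\<bar> < 1 \<and> \<bar>y\<bar> < 1 \<and> \<sigma> * (x - y) > 0 \<and> \<tau> * (x + y) > 0}"

text \<open>All inequalities that define \<open>Omega\<close>, and the inverse of \<open>lift_map\<close> on a quarter, come from these
factorizations.\<close>

lemma lift_map_square:
  "1 - fst (lift_map z) + snd (lift_map z) = (fst z - snd z)\<^sup>2"
  "1 + fst (lift_map z) + snd (lift_map z) = (fst z + snd z)\<^sup>2"
  "(fst (lift_map z))\<^sup>2 - 4 * snd (lift_map z) = 4 * (1 - (fst z)\<^sup>2) * (1 - (snd z)\<^sup>2)"
  by (simp_all add: fst_lift_map snd_lift_map power2_eq_square algebra_simps)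

text \<open>Within one quarter the signs of \<open>x - y\<close> and \<open>x + y\<close> are fixed, so the point can be recovered from its
image. This gives injectivity, and it turns \<open>chi i j\<close> into a function of the image.\<close>

lemma sqrt_lift_map:
  assumes "z \<in> quarter \<sigma> \<tau>" "\<sigma> \<in> {-1, 1}" "\<tau> \<in> {-1, 1}"
  shows "sqrt (1 - fst (lift_map z) + snd (lift_map z)) = \<sigma> * (fst z - snd z)"
    "sqrt (1 + fst (lift_map z) + snd (lift_map z)) = \<tau> * (fst z + snd z)"
  using assms unfolding lift_map_square by (auto simp: quarter_def abs_if)

lemma inj_on_lift_map_quarter:
  assumes "\<sigma> \<in> {-1, 1}" "\<tau> \<in> {-1, 1}"
  shows "inj_on lift_map (quarter \<sigma> \<tau>)"
proof (rule inj_onI)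
  fix z z' assume "z \<in> quarter \<sigma> \<tau>" "z' \<in> quarter \<sigma> \<tau>" "lift_map z = lift_map z'"
  then have "\<sigma> * (fst z - snd z) = \<sigma> * (fst z' - snd z')" "\<tau> * (fst z + snd z) = \<tau> * (fst z' + snd z')"
    using sqrt_lift_map[OF _ assms] by metis+
  then have "fst z - snd z = fst z' - snd z'" "fst z + snd z = fst z' + snd z'"
    using assms by auto
  then show "z = z'" by (simp add: prod_eq_iff)
qed

text \<open>For surjectivity put \<open>a = sqrt (1 - u + v)\<close> and \<open>b = sqrt (1 + u + v)\<close>, which up to sign must be the
values of \<open>x - y\<close> and \<open>x + y\<close>. The resulting point lies in the square iff \<open>a + b < 2\<close>. Since
\<open>a\<^sup>2 + b\<^sup>2 = 2 + 2v\<close>, this is \<open>a b < 1 - v\<close>, and squaring turns that into \<open>4 v < u\<^sup>2\<close>.\<close>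

lemma lift_map_quarter:
  assumes "\<sigma> \<in> {-1, 1}" "\<tau> \<in> {-1, 1}"
  shows "lift_map ` quarter \<sigma> \<tau> = Omega"
proof
  show "lift_map ` quarter \<sigma> \<tau> \<subseteq> Omega"
  proof (rule image_subsetI)
    fix z assume z: "z \<in> quarter \<sigma> \<tau>"
    then have b: "\<bar>fst z\<bar> < 1" "\<bar>snd z\<bar> < 1" "fst z \<noteq> snd z" "fst z + snd z \<noteq> 0"
      by (auto simp: quarter_def)
    then have "(fst z - snd z)\<^sup>2 > 0" "(fst z + snd z)\<^sup>2 > 0" by auto
    moreover have "4 * (1 - (fst z)\<^sup>2) * (1 - (snd z)\<^sup>2) > 0"
      using b by (auto simp: abs_square_less_1 intro!: mult_pos_pos)
    moreover have "\<bar>fst z\<bar> * \<bar>snd z\<bar> < 1"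
      using b mult_strict_mono'[of "\<bar>fst z\<bar>" 1 "\<bar>snd z\<bar>" 1] by simp
    then have "\<bar>fst (lift_map z)\<bar> < 2" by (simp add: fst_lift_map abs_mult)
    ultimately show "lift_map z \<in> Omega"
      unfolding lift_map_square[symmetric] Omega_def by (auto simp: case_prod_beta)
  qed
  show "Omega \<subseteq> lift_map ` quarter \<sigma> \<tau>"
  proof
    fix p assume "p \<in> Omega"
    then obtain u v where p: "p = (u, v)" "0 < 1 + u + v" "0 < 1 - u + v" "4 * v < u\<^sup>2" "\<bar>u\<bar> < 2"
      by (auto simp: Omega_def)
    define a b where "a = sqrt (1 - u + v)" and "b = sqrt (1 + u + v)"
    have ab: "a > 0" "b > 0" "a\<^sup>2 = 1 - u + v" "b\<^sup>2 = 1 + u + v" using p by (auto simp: a_def b_def)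
    have "u\<^sup>2 < 2\<^sup>2" using power_strict_mono[OF p(5), of 2] by simp
    then have v: "v < 1" using p(4) by simp
    have "(a * b)\<^sup>2 < (1 - v)\<^sup>2"
      using p(4) by (simp add: power_mult_distrib ab) (simp add: power2_eq_square algebra_simps)
    then have "a * b < 1 - v" using v by (simp add: power_less_imp_less_base)
    then have "(a + b)\<^sup>2 < 2\<^sup>2"
      using ab(3,4) by (simp add: power2_sum)
    then have sum: "a + b < 2" by (rule power_less_imp_less_base) simp
    define z where "z = ((\<tau> * b + \<sigma> * a) / 2, (\<tau> * b - \<sigma> * a) / 2)"
    have z': "fst z - snd z = \<sigma> * a" "fst z + snd z = \<tau> * b"
      by (simp_all add: z_def field_simps)
    have "z \<in> quarter \<sigma> \<tau>"
      using assms ab(1,2) sum by (auto simp: quarter_def z_def abs_less_iff field_simps)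
    moreover have "lift_map z = p"
    proof -
      have "\<sigma>\<^sup>2 = 1" "\<tau>\<^sup>2 = 1" using assms by auto
      then have "1 - fst (lift_map z) + snd (lift_map z) = 1 - u + v" "1 + fst (lift_map z) + snd (lift_map z) = 1 + u + v"
        unfolding lift_map_square z' by (simp_all add: power_mult_distrib ab)
      then show ?thesis by (simp add: p(1) prod_eq_iff)
    qed
    ultimately show "p \<in> lift_map ` quarter \<sigma> \<tau>" by blast
  qed
qed

lemma bounded_Omega: "bounded Omega"
proof (rule bounded_subset[OF bounded_cbox])
  show "Omega \<subseteq> cbox (-2, -1) (2, 1)"
  proof
    fix p assume "p \<in> Omega"
    then obtain u v where p: "p = (u, v)" "0 < 1 + u + v" "0 < 1 - u + v" "4 * v < u\<^sup>2" "\<bar>u\<bar> < 2"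
      by (auto simp: Omega_def)
    have "u\<^sup>2 < 2\<^sup>2" using power_strict_mono[OF p(5), of 2] by simp
    then show "p \<in> cbox (-2, -1) (2, 1)" using p by (auto simp: cbox_Pair_eq)
  qed
qed

lemma open_Omega: "open Omega"
  unfolding Omega_def case_prod_beta
  by (intro open_Collect_conj open_Collect_less continuous_intros)

lemma open_quarter: "open (quarter \<sigma> \<tau>)"
  unfolding quarter_def case_prod_beta
  by (intro open_Collect_conj open_Collect_less continuous_intros)

lemma quarter_subset_square: "quarter \<sigma> \<tau> \<subseteq> square"
  by (auto simp: quarter_def)

lemma bounded_square: "bounded square"
  by (simp add: bounded_Times)

lemma has_derivative_lift_map:
  "(lift_map has_derivative (\<lambda>(h, k). (2 * snd z * h + 2 * fst z * k, 2 * fst z * h + 2 * snd z * k))) (at z)"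
proof -
  have "((\<lambda>z. (2 * fst z * snd z, (fst z)\<^sup>2 + (snd z)\<^sup>2 - 1)) has_derivative
      (\<lambda>h. (2 * snd z * fst h + 2 * fst z * snd h, 2 * fst z * fst h + 2 * snd z * snd h))) (at z)"
    by (auto intro!: derivative_eq_intros simp: algebra_simps)
  then show ?thesis by (simp add: lift_map_def case_prod_beta')
qed

lemma lift_map_quarter_integral:
  fixes f :: "real \<times> real \<Rightarrow> real"
  assumes "\<sigma> \<in> {-1, 1}" "\<tau> \<in> {-1, 1}" and f: "f absolutely_integrable_on Omega"
  shows "(\<lambda>z. f (lift_map z) * \<bar>(fst z)\<^sup>2 - (snd z)\<^sup>2\<bar>) absolutely_integrable_on quarter \<sigma> \<tau>"
    "integral (quarter \<sigma> \<tau>) (\<lambda>z. f (lift_map z) * \<bar>(fst z)\<^sup>2 - (snd z)\<^sup>2\<bar>) = integral Omega f / 4"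
proof -
  let ?g = "\<lambda>z. f (lift_map z) * \<bar>(fst z)\<^sup>2 - (snd z)\<^sup>2\<bar>"
  have bd: "bounded (quarter \<sigma> \<tau>)" using bounded_subset[OF bounded_square quarter_subset_square] .
  have e: "\<bar>2 * snd z * (2 * snd z) - 2 * fst z * (2 * fst z)\<bar> * f (lift_map z) = 4 * ?g z" for z
  proof -
    have "2 * snd z * (2 * snd z) - 2 * fst z * (2 * fst z) = (-4) * ((fst z)\<^sup>2 - (snd z)\<^sup>2)"
      by (simp add: power2_eq_square)
    then show ?thesis by (simp only: abs_mult) simp
  qed
  from pair_change_of_variables[OF open_quarter bd _ inj_on_lift_map_quarter[OF assms(1,2)] has_derivative_lift_map,
      of f "integral Omega f"] f
  have g: "(\<lambda>z. 4 * ?g z) absolutely_integrable_on quarter \<sigma> \<tau>" "integral (quarter \<sigma> \<tau>) (\<lambda>z. 4 * ?g z) = integral Omega f"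
    unfolding e by (auto simp: lift_map_quarter[OF assms(1,2)] bounded_Omega)
  from set_integrable_mult_right[of "1/4", OF g(1)]
  show "?g absolutely_integrable_on quarter \<sigma> \<tau>" by (simp add: mult.assoc)
  from g(2) show "integral (quarter \<sigma> \<tau>) ?g = integral Omega f / 4" by simp
qed

lemma absolutely_integrable_continuous_times:
  fixes f g :: "'a::euclidean_space \<Rightarrow> real"
  assumes "continuous_on UNIV f" "bounded S" "S \<in> sets lebesgue" "g absolutely_integrable_on S"
  shows "(\<lambda>z. f z * g z) absolutely_integrable_on S"
proof (rule absolutely_integrable_bounded_measurable_product[OF bilinear_times])
  show "f \<in> borel_measurable (lebesgue_on S)"
    by (intro continuous_imp_measurable_on_sets_lebesgue continuous_on_subset[OF assms(1)] assms) auto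
  have "bounded (f ` closure S)"
    by (intro compact_imp_bounded compact_continuous_image continuous_on_subset[OF assms(1)])
      (use assms(2) in auto)
  then show "bounded (f ` S)"
    using bounded_subset closure_subset image_mono by metis
qed (use assms in auto)

lemma weighted_ip_eq_integral:
  assumes "(\<lambda>z. f z * g z * W z) absolutely_integrable_on D"
  shows "weighted_ip D W f g = integral D (\<lambda>z. f z * g z * W z)"
  unfolding weighted_ip_def using set_lebesgue_integral_eq_integral(2)[OF assms] .

text \<open>The signs are determined by any point of the quarter, so that the quarters are pairwise disjoint.\<close>

lemma quarter_sgn:
  assumes "\<sigma> \<in> {-1, 1}" "\<tau> \<in> {-1, 1}" "z \<in> quarter \<sigma> \<tau>"
  shows "\<sigma> = sgn (fst z - snd z)" "\<tau> = sgn (fst z + snd z)"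
proof -
  have "\<sigma> * (fst z - snd z) > 0" "\<tau> * (fst z + snd z) > 0"
    using assms(3) by (auto simp: quarter_def)
  then show "\<sigma> = sgn (fst z - snd z)" "\<tau> = sgn (fst z + snd z)"
    using assms(1,2) by auto
qed

lemma negligible_square_minus_quarters:
  "negligible (square - (\<Union>\<sigma>\<in>{-1, 1}. \<Union>\<tau>\<in>{-1, 1}. quarter \<sigma> \<tau>))"
proof (rule negligible_subset)
  let ?H = "\<lambda>a c. {z :: real \<times> real. a \<bullet> z = c}"
  let ?N = "?H (1, 0) 1 \<union> ?H (1, 0) (-1) \<union> ?H (0, 1) 1 \<union> ?H (0, 1) (-1) \<union> ?H (1, 1) 0 \<union> ?H (1, -1) 0"
  show "square - (\<Union>\<sigma>\<in>{-1, 1}. \<Union>\<tau>\<in>{-1, 1}. quarter \<sigma> \<tau>) \<subseteq> ?N"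
  proof (rule subsetI, rule ccontr)
    fix z assume z: "z \<in> square - (\<Union>\<sigma>\<in>{-1, 1}. \<Union>\<tau>\<in>{-1, 1}. quarter \<sigma> \<tau>)" and "z \<notin> ?N"
    obtain x y where xy: "z = (x, y)" by fastforce
    with z \<open>z \<notin> ?N\<close> have "\<bar>x\<bar> < 1" "\<bar>y\<bar> < 1" "x - y \<noteq> 0" "x + y \<noteq> 0"
      by auto
    then have "z \<in> quarter (sgn (x - y)) (sgn (x + y))"
      by (auto simp: quarter_def xy sgn_real_def)
    moreover have "sgn (x - y) \<in> {-1, 1}" "sgn (x + y) \<in> {-1, 1}"
      using \<open>x - y \<noteq> 0\<close> \<open>x + y \<noteq> 0\<close> by (simp_all add: sgn_real_def)
    ultimately show False using z by blast
  qed
  show "negligible ?N"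
    by (intro negligible_Un negligible_hyperplane) (auto simp: zero_prod_def)
qed

lemma disjoint_quarters:
  assumes "\<sigma> \<in> {-1, 1}" "\<tau> \<in> {-1, 1}" "\<sigma>' \<in> {-1, 1}" "\<tau>' \<in> {-1, 1}" "(\<sigma>, \<tau>) \<noteq> (\<sigma>', \<tau>')"
  shows "quarter \<sigma> \<tau> \<inter> quarter \<sigma>' \<tau>' = {}"
  using quarter_sgn[OF assms(1,2)] quarter_sgn[OF assms(3,4)] assms(5) by blast

text \<open>On the quarter with signs \<open>\<sigma>\<close>, \<open>\<tau>\<close> the factor \<open>chi i j\<close> is \<open>\<sigma> ^ i * \<tau> ^ j\<close> times a function \<open>G\<close> of the
image in \<open>Omega\<close>, so each quarter contributes \<open>\<sigma> ^ i * \<tau> ^ j / 4\<close> times one and the same integral over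
\<open>Omega\<close>. Summed over the signs, the contributions cancel unless \<open>i\<close> and \<open>j\<close> are both even.\<close>

proposition chi_moment:
  fixes f W :: "real \<times> real \<Rightarrow> real"
  assumes W: "W absolutely_integrable_on Omega" and f: "continuous_on UNIV f"
  shows "(\<lambda>z. chi i j z * f (lift_map z) * lift_weight W z) absolutely_integrable_on square"
    "integral square (\<lambda>z. chi i j z * f (lift_map z) * lift_weight W z) =
      (if even i \<and> even j
       then integral Omega (\<lambda>z. (1 - fst z + snd z) ^ (i div 2) * (1 + fst z + snd z) ^ (j div 2) * (f z * W z))
       else 0)"
proof -
  define I :: "(real \<times> real) set" where "I = {-1, 1} \<times> {-1, 1}"
  define Q where "Q = (\<lambda>(\<sigma>, \<tau>). quarter \<sigma> \<tau>)"
  define h where "h = (\<lambda>z. chi i j z * f (lift_map z) * lift_weight W z)"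
  \<comment> \<open>The function on \<open>Omega\<close> that represents the integrand on each quarter, up to sign and Jacobian.\<close>
  define G where "G z = sqrt (1 - fst z + snd z) ^ i * sqrt (1 + fst z + snd z) ^ j * f z * W z" for z
  have G: "G absolutely_integrable_on Omega"
    unfolding G_def
    by (intro absolutely_integrable_continuous_times W continuous_intros f bounded_Omega)
      (simp add: open_Omega borel_open)
  have piece: "h absolutely_integrable_on Q p \<and> integral (Q p) h = fst p ^ i * snd p ^ j * (integral Omega G / 4)"
    if pI: "p \<in> I" for p
  proof -
    obtain \<sigma> \<tau> where p: "p = (\<sigma>, \<tau>)" "\<sigma> \<in> {-1, 1}" "\<tau> \<in> {-1, 1}"
      using pI unfolding I_def by (elim SigmaE)
    let ?g = "\<lambda>z. G (lift_map z) * \<bar>(fst z)\<^sup>2 - (snd z)\<^sup>2\<bar>"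
    have eq: "h z = (\<sigma> ^ i * \<tau> ^ j) * ?g z" if "z \<in> Q p" for z
    proof -
      have "\<sigma> ^ i * \<sigma> ^ i = 1" "\<tau> ^ j * \<tau> ^ j = 1"
        using p(2,3) by (auto simp flip: power_mult_distrib)
      then have "\<sigma> ^ i * (\<tau> ^ j * (\<sigma> ^ i * \<tau> ^ j)) = 1"
        by (simp add: mult.left_commute)
      then show ?thesis
        using sqrt_lift_map[OF _ p(2,3), of z] that
        by (simp add: Q_def p(1) h_def G_def lift_weight_def chi_def case_prod_beta power_mult_distrib)
    qed
    note g = lift_map_quarter_integral[OF p(2,3) G]
    have "(\<lambda>z. (\<sigma> ^ i * \<tau> ^ j) * ?g z) absolutely_integrable_on Q p"
      using set_integrable_mult_right[OF g(1)] by (simp add: Q_def p(1))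
    then have "h absolutely_integrable_on Q p"
      by (rule absolutely_integrable_spike[OF _ negligible_empty]) (use eq in auto)
    moreover have "integral (Q p) h = integral (Q p) (\<lambda>z. (\<sigma> ^ i * \<tau> ^ j) * ?g z)"
      by (rule integral_cong) (use eq in auto)
    ultimately show ?thesis using g(2) by (simp add: Q_def p(1))
  qed
  have fin: "finite I" by (simp add: I_def)
  have U: "(\<Union>p\<in>I. Q p) = (\<Union>\<sigma>\<in>{-1, 1}. \<Union>\<tau>\<in>{-1, 1}. quarter \<sigma> \<tau>)"
    by (auto simp: I_def Q_def)
  have AU: "h absolutely_integrable_on (\<Union>p\<in>I. Q p)"
    by (rule set_integrable_UN[OF fin]) (use piece in \<open>auto simp: Q_def open_quarter borel_open\<close>)
  have sub: "(\<Union>p\<in>I. Q p) - square = {}"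
    using quarter_subset_square by (auto simp: Q_def)
  have neg: "negligible (square - (\<Union>p\<in>I. Q p))" unfolding U by (rule negligible_square_minus_quarters)
  \<comment> \<open>The quarters miss only the edges and diagonals of the square.\<close>
  have n1: "negligible {x \<in> (\<Union>p\<in>I. Q p) - square. h x \<noteq> 0}"
    by (rule negligible_subset[OF negligible_empty]) (use sub in blast)
  have n2: "negligible {x \<in> square - (\<Union>p\<in>I. Q p). h x \<noteq> 0}" by (rule negligible_subset[OF neg]) auto
  show "h absolutely_integrable_on square"
    using absolutely_integrable_spike_set[OF AU n1 n2] .
  have "(h has_integral (\<Sum>p\<in>I. integral (Q p) h)) (\<Union>p\<in>I. Q p)"
  proof (rule has_integral_UN[OF fin])
    show "(h has_integral integral (Q p) h) (Q p)" if "p \<in> I" for p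
      using piece[OF that] set_lebesgue_integral_eq_integral(1) by blast
    show "pairwise (\<lambda>p q. negligible (Q p \<inter> Q q)) I"
      unfolding pairwise_def I_def Q_def using disjoint_quarters by auto
  qed
  then have "integral square h = (\<Sum>p\<in>I. integral (Q p) h)"
    using integral_spike_set[OF n1 n2] by (simp add: integral_unique)
  also have "\<dots> = (\<Sum>p\<in>I. fst p ^ i * snd p ^ j * (integral Omega G / 4))"
    by (rule sum.cong) (use piece in auto)
  also have "\<dots> = ((-1) ^ i + 1) * ((-1) ^ j + 1) * (integral Omega G / 4)"
    by (simp add: I_def sum.cartesian_product[symmetric] algebra_simps)
  also have "\<dots> = (if even i \<and> even j then integral Omega G else 0)"
    by auto
  also have "\<dots> = (if even i \<and> even j
       then integral Omega (\<lambda>z. (1 - fst z + snd z) ^ (i div 2) * (1 + fst z + snd z) ^ (j div 2) * (f z * W z))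
       else 0)"
  proof -
    have "G z = (1 - fst z + snd z) ^ (i div 2) * (1 + fst z + snd z) ^ (j div 2) * (f z * W z)"
      if "even i" "even j" "z \<in> Omega" for z
    proof -
      have "sqrt a ^ k = a ^ (k div 2)" if "even k" "a \<ge> 0" for k a
        using that by (elim evenE) (simp add: power_mult)
      then show ?thesis using that by (auto simp: G_def Omega_def)
    qed
    then show ?thesis by (auto intro!: integral_cong)
  qed
  finally show "integral square h = \<dots>" .
qed

section \<open>Orthogonal polynomials and orthonormal bases\<close>

lemma weighted_ip_commute: "weighted_ip D W f g = weighted_ip D W g f"
  unfolding weighted_ip_def by (simp add: mult.commute)

lemma weighted_ip_zero [simp]: "weighted_ip D W f (\<lambda>z. 0) = 0" "weighted_ip D W (\<lambda>z. 0) f = 0"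
  by (simp_all add: weighted_ip_def)

lemma weighted_ip_scale: "weighted_ip D W (\<lambda>z. a * f z) g = a * weighted_ip D W f g"
  unfolding weighted_ip_def by (simp add: mult.assoc)

lemma weighted_ip_sum:
  assumes D: "bounded D" "D \<in> sets lebesgue" "W absolutely_integrable_on D"
    and cont: "\<And>k. k \<in> K \<Longrightarrow> continuous_on UNIV (B k)" "continuous_on UNIV g"
    and "finite K"
  shows "weighted_ip D W (\<lambda>z. \<Sum>k\<in>K. B k z) g = (\<Sum>k\<in>K. weighted_ip D W (B k) g)"
proof -
  have int: "(\<lambda>z. (f z * g z) * W z) absolutely_integrable_on D" if "continuous_on UNIV f" for f
    by (rule absolutely_integrable_continuous_times[OF _ D]) (intro continuous_intros that cont)
  have "weighted_ip D W (\<lambda>z. \<Sum>k\<in>K. B k z) g = integral D (\<lambda>z. (\<Sum>k\<in>K. B k z) * g z * W z)"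
    by (rule weighted_ip_eq_integral[OF int]) (intro continuous_intros cont)
  also have "\<dots> = integral D (\<lambda>z. \<Sum>k\<in>K. B k z * g z * W z)"
    by (simp add: sum_distrib_right)
  also have "\<dots> = (\<Sum>k\<in>K. integral D (\<lambda>z. B k z * g z * W z))"
    by (rule integral_sum[OF assms(6)]) (use int cont(1) set_lebesgue_integral_eq_integral(1) in blast)
  also have "\<dots> = (\<Sum>k\<in>K. weighted_ip D W (B k) g)"
    by (intro sum.cong refl weighted_ip_eq_integral[symmetric] int cont)
  finally show ?thesis .
qed

lemma weighted_ip_orthonormal_sum:
  assumes D: "bounded D" "D \<in> sets lebesgue" "W absolutely_integrable_on D"
    and cont: "\<And>k. k \<in> K \<Longrightarrow> continuous_on UNIV (B k)" and "finite K" "l \<in> K"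
    and on: "\<And>k l. k \<in> K \<Longrightarrow> l \<in> K \<Longrightarrow> weighted_ip D W (B k) (B l) = (if k = l then 1 else 0)"
  shows "weighted_ip D W (\<lambda>z. \<Sum>k\<in>K. c k * B k z) (B l) = c l"
proof -
  have "weighted_ip D W (\<lambda>z. \<Sum>k\<in>K. c k * B k z) (B l) = (\<Sum>k\<in>K. c k * weighted_ip D W (B k) (B l))"
    by (subst weighted_ip_sum[OF D])
      (auto simp: weighted_ip_scale intro!: continuous_intros cont assms)
  also have "\<dots> = (\<Sum>k\<in>K. if k = l then c k else 0)"
    by (rule sum.cong) (use on assms(6) in auto)
  finally show ?thesis using assms(5,6) by simp
qed

lemma orth_polys_iff:
  "P \<in> orth_polys D W n \<longleftrightarrow> P \<in> polys_below (Suc n) \<and> (\<forall>Q\<in>polys_below n. weighted_ip D W P Q = 0)"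
proof (cases n)
  case 0
  then show ?thesis by (simp add: orth_polys_def polys2_eq_below polys_below_0)
next
  case (Suc m)
  have "(\<forall>l<Suc m. \<forall>Q\<in>polys_below (Suc l). weighted_ip D W P Q = 0) \<longleftrightarrow> (\<forall>Q\<in>polys_below (Suc m). weighted_ip D W P Q = 0)"
    using polys_below_mono by (metis Suc_leI lessI)
  then show ?thesis by (simp add: orth_polys_def polys2_eq_below Suc)
qed

lemma onb_on_reindex:
  assumes h: "bij_betw h K' K" and onb: "onb_on K B D W V"
  shows "onb_on K' (\<lambda>k. B (h k)) D W V"
proof -
  have hK: "h k \<in> K" if "k \<in> K'" for k using h that bij_betwE by blast
  have reindex: "(\<Sum>k\<in>K'. F (h k)) = (\<Sum>k\<in>K. F k)" for F :: "_ \<Rightarrow> real"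
    by (rule sum.reindex_bij_betw[OF h])
  note on = onb[unfolded onb_on_def]
  show ?thesis
    unfolding onb_on_def
  proof (intro conjI ballI allI impI)
    show "B (h k) \<in> V" if "k \<in> K'" for k using on hK[OF that] by blast
    show "weighted_ip D W (B (h k)) (B (h l)) = (if k = l then 1 else 0)" if "k \<in> K'" "l \<in> K'" for k l
      using on hK[OF that(1)] hK[OF that(2)] h that by (auto simp: bij_betw_def inj_on_eq_iff)
  next
    fix f assume "f \<in> V"
    then obtain c where "\<And>z. f z = (\<Sum>k\<in>K. c k * B k z)" using on by blast
    then have "f z = (\<Sum>k\<in>K'. c (h k) * B (h k) z)" for z
      using reindex[of "\<lambda>k. c k * B k z"] by simp
    then show "\<exists>c. \<forall>z. f z = (\<Sum>k\<in>K'. c k * B (h k) z)" by (intro exI[of _ "\<lambda>k. c (h k)"] allI)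
  next
    fix c k assume c: "\<forall>z. (\<Sum>k\<in>K'. c k * B (h k) z) = 0" and k: "k \<in> K'"
    define g where "g = the_inv_into K' h"
    have g: "g (h k) = k" if "k \<in> K'" for k
      unfolding g_def using h that by (auto simp: bij_betw_def the_inv_into_f_f)
    have "(\<Sum>k\<in>K. c (g k) * B k z) = 0" for z
      using c[rule_format, of z] reindex[of "\<lambda>k. c (g k) * B k z"] g by simp
    moreover have "(\<forall>z. (\<Sum>k\<in>K. c' k * B k z) = 0) \<longrightarrow> (\<forall>k\<in>K. c' k = 0)" for c'
      using on by blast
    from this[of "\<lambda>k. c (g k)"] calculation have "c (g (h k)) = 0" using hK[OF k] by simp
    then show "c k = 0" using g[OF k] by simp
  qed
qed

section \<open>Lifting four families of orthonormal bases\<close>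

text \<open>The weights \<open>W_mod w \<gamma> i j\<close> with an arbitrary \<open>W\<close> in the place of \<open>W_weight w \<gamma>\<close> and arbitrary
constants \<open>r i j\<close> as normalization.\<close>

definition mod_weight :: "(real \<times> real \<Rightarrow> real) \<Rightarrow> (nat \<Rightarrow> nat \<Rightarrow> real) \<Rightarrow> nat \<Rightarrow> nat \<Rightarrow> real \<times> real \<Rightarrow> real" where
  "mod_weight W r i j = (\<lambda>z. r i j * (1 - fst z + snd z) ^ i * (1 + fst z + snd z) ^ j * W z)"

lemma continuous_lift_map: "continuous_on UNIV lift_map"
  unfolding lift_map_def case_prod_beta by (intro continuous_intros)

lemma continuous_chi: "continuous_on UNIV (chi i j)"
  unfolding chi_def case_prod_beta by (intro continuous_intros)

lemma continuous_chi_lift_map: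
  "continuous_on UNIV f \<Longrightarrow> continuous_on UNIV (\<lambda>z. chi i j z * f (lift_map z))"
  by (intro continuous_intros continuous_chi continuous_on_compose2[OF _ continuous_lift_map]) auto

definition parity_index :: "nat \<Rightarrow> (nat \<times> nat) set" where
  "parity_index N = {(i, j). i \<le> 1 \<and> j \<le> 1 \<and> i + j \<le> N \<and> even (N - i - j)}"

text \<open>The pair \<open>(i, j)\<close> selects a parity class, and \<open>k\<close> numbers the basis of the orthogonal polynomials of
degree \<open>(N - i - j) div 2\<close> for the weight of that class.\<close>

definition full_index :: "nat \<Rightarrow> ((nat \<times> nat) \<times> nat) set" where
  "full_index N = Sigma (parity_index N) (\<lambda>(i, j). {..(N - i - j) div 2})"

lemma finite_index: "finite (parity_index N)"
  by (rule finite_subset[of _ "{..1} \<times> {..1}"]) (auto simp: parity_index_def)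

lemma finite_full_index: "finite (full_index N)"
  unfolding full_index_def by (intro finite_SigmaI finite_index) auto

lemma full_index_iff:
  "((i, j), k) \<in> full_index N \<longleftrightarrow> i \<le> 1 \<and> j \<le> 1 \<and> i + j + 2 * k \<le> N \<and> even (N + i + j)"
proof -
  have "k \<le> (N - i - j) div 2 \<longleftrightarrow> 2 * k \<le> N - i - j"
    by (simp add: less_eq_div_iff_mult_less_eq mult.commute)
  then have "((i, j), k) \<in> full_index N \<longleftrightarrow>
      i \<le> 1 \<and> j \<le> 1 \<and> i + j \<le> N \<and> even (N - i - j) \<and> 2 * k \<le> N - i - j"
    by (auto simp: full_index_def parity_index_def)
  also have "\<dots> \<longleftrightarrow> i \<le> 1 \<and> j \<le> 1 \<and> i + j + 2 * k \<le> N \<and> even (N - (i + j))"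
    by auto
  also have "\<dots> \<longleftrightarrow> i \<le> 1 \<and> j \<le> 1 \<and> i + j + 2 * k \<le> N \<and> even (N + i + j)"
    by (auto simp: even_diff_nat add.assoc)
  finally show ?thesis .
qed

lemma full_index_even: "full_index (2 * n) = Pair (0, 0) ` {..n} \<union> Pair (1, 1) ` {..<n}"
proof (rule set_eqI)
  fix a :: "(nat \<times> nat) \<times> nat"
  obtain i j k where a: "a = ((i, j), k)" by (metis surj_pair)
  show "a \<in> full_index (2 * n) \<longleftrightarrow> a \<in> Pair (0, 0) ` {..n} \<union> Pair (1, 1) ` {..<n}"
    unfolding a full_index_iff by (auto simp: image_iff le_Suc_eq)
qed

lemma full_index_odd: "full_index (2 * n + 1) = Pair (0, 1) ` {..n} \<union> Pair (1, 0) ` {..n}"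
proof (rule set_eqI)
  fix a :: "(nat \<times> nat) \<times> nat"
  obtain i j k where a: "a = ((i, j), k)" by (metis surj_pair)
  show "a \<in> full_index (2 * n + 1) \<longleftrightarrow> a \<in> Pair (0, 1) ` {..n} \<union> Pair (1, 0) ` {..n}"
    unfolding a full_index_iff by (auto simp: image_iff le_Suc_eq)
qed

text \<open>In the application \<open>r i j\<close> is the ratio of normalizing constants, that is, the square of
\<open>b_const w \<gamma> i j\<close>, and \<open>B i j\<close> is one of \<open>P\<close>, \<open>P01\<close>, \<open>P10\<close>, \<open>P11\<close>. Numbering the four cases by
\<open>(i, j)\<close> lets one argument treat them all.\<close>

locale lifted_bases =
  fixes W :: "real \<times> real \<Rightarrow> real" and r :: "nat \<Rightarrow> nat \<Rightarrow> real"
    and B :: "nat \<Rightarrow> nat \<Rightarrow> nat \<Rightarrow> nat \<Rightarrow> real \<times> real \<Rightarrow> real"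
  assumes W_integrable: "W absolutely_integrable_on Omega"
    and r_pos: "i \<le> 1 \<Longrightarrow> j \<le> 1 \<Longrightarrow> r i j > 0"
    and B_onb: "i \<le> 1 \<Longrightarrow> j \<le> 1 \<Longrightarrow>
      onb_on {..n} (\<lambda>k. B i j k n) Omega (mod_weight W r i j) (orth_polys Omega (mod_weight W r i j) n)"
begin

lemma mod_weight_integrable: "mod_weight W r i j absolutely_integrable_on Omega"
  unfolding mod_weight_def
  by (intro absolutely_integrable_continuous_times W_integrable continuous_intros bounded_Omega)
    (simp add: open_Omega borel_open)

lemma Omega_sets: "Omega \<in> sets lebesgue"
  by (simp add: open_Omega borel_open)

lemma square_sets: "square \<in> sets lebesgue"
  by (simp add: borel_closed closed_Times)

lemma lift_weight_integrable: "lift_weight W absolutely_integrable_on square"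
  using chi_moment(1)[OF W_integrable, of "\<lambda>z. 1" 0 0] by (simp add: chi_def case_prod_beta)

text \<open>The product of the two functions is \<open>chi (i + i') (j + j')\<close> times a function of the image point. For
\<open>i, j, i', j' \<le> 1\<close> both sums are even exactly when the classes agree, and then \<open>(x - y)\<^sup>2\<^sup>i\<close> and
\<open>(x + y)\<^sup>2\<^sup>j\<close> supply the factors of \<open>mod_weight\<close>.\<close>

lemma weighted_ip_chi:
  assumes cont: "continuous_on UNIV f" "continuous_on UNIV g" and ij: "i \<le> 1" "j \<le> 1" "i' \<le> 1" "j' \<le> 1"
  shows "r i j * weighted_ip square (lift_weight W) (\<lambda>z. chi i j z * f (lift_map z)) (\<lambda>z. chi i' j' z * g (lift_map z)) =
    (if i = i' \<and> j = j' then weighted_ip Omega (mod_weight W r i j) f g else 0)"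
proof -
  let ?f = "\<lambda>z. chi i j z * f (lift_map z)" and ?g = "\<lambda>z. chi i' j' z * g (lift_map z)"
  let ?h = "\<lambda>z. f z * g z"
  have h: "continuous_on UNIV ?h" by (intro continuous_intros cont)
  have prod: "?f z * ?g z * lift_weight W z = chi (i + i') (j + j') z * ?h (lift_map z) * lift_weight W z" for z
    by (simp add: chi_def case_prod_beta power_add)
  note m = chi_moment[OF W_integrable h, of "i + i'" "j + j'"]
  have ip: "weighted_ip square (lift_weight W) ?f ?g =
      integral square (\<lambda>z. chi (i + i') (j + j') z * ?h (lift_map z) * lift_weight W z)"
    using weighted_ip_eq_integral[where f = ?f and g = ?g and W = "lift_weight W" and D = square] m(1) unfolding prod by blast
  show ?thesis
  proof (cases "i = i' \<and> j = j'")
    case True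
    have "weighted_ip Omega (mod_weight W r i j) f g = integral Omega (\<lambda>z. f z * g z * mod_weight W r i j z)"
      by (intro weighted_ip_eq_integral absolutely_integrable_continuous_times h bounded_Omega Omega_sets mod_weight_integrable)
    also have "\<dots> = integral Omega (\<lambda>z. r i j * ((1 - fst z + snd z) ^ i * (1 + fst z + snd z) ^ j * (?h z * W z)))"
      by (simp add: mod_weight_def mult_ac)
    also have "\<dots> = r i j * weighted_ip square (lift_weight W) ?f ?g"
      unfolding ip m(2) using True by simp
    finally show ?thesis using True by simp
  next
    case False
    then have parity: "\<not> (even (i + i') \<and> even (j + j'))"
      using ij by (auto simp: le_Suc_eq)
    show ?thesis
      unfolding ip m(2) if_not_P[OF parity] if_not_P[OF False] by simp
  qed
qed

lemma weighted_ip_parity_component: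
  assumes f: "continuous_on UNIV f" and g: "\<And>i j. i \<le> 1 \<Longrightarrow> j \<le> 1 \<Longrightarrow> continuous_on UNIV (g i j)"
    and Q: "\<And>z. Q z = (\<Sum>i\<le>1. \<Sum>j\<le>1. chi i j z * g i j (lift_map z))"
    and ij: "i \<le> 1" "j \<le> 1"
  shows "r i j * weighted_ip square (lift_weight W) (\<lambda>z. chi i j z * f (lift_map z)) Q =
    weighted_ip Omega (mod_weight W r i j) f (g i j)"
proof -
  let ?f = "\<lambda>z. chi i j z * f (lift_map z)"
  let ?g = "\<lambda>p z. chi (fst p) (snd p) z * g (fst p) (snd p) (lift_map z)"
  have "Q = (\<lambda>z. \<Sum>p\<in>{..1} \<times> {..1}. ?g p z)"
    unfolding fun_eq_iff Q sum.cartesian_product by (simp add: case_prod_beta del: sum.atMost_Suc)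
  then have "weighted_ip square (lift_weight W) ?f Q =
      (\<Sum>p\<in>{..1} \<times> {..1}. weighted_ip square (lift_weight W) (?g p) ?f)"
    using weighted_ip_sum[OF bounded_square square_sets lift_weight_integrable, of "{..1} \<times> {..1}" ?g ?f]
      weighted_ip_commute continuous_chi_lift_map[OF f] continuous_chi_lift_map[OF g]
    by auto
  then have "r i j * weighted_ip square (lift_weight W) ?f Q =
      (\<Sum>p\<in>{..1} \<times> {..1}. r i j * weighted_ip square (lift_weight W) ?f (?g p))"
    by (simp only: sum_distrib_left weighted_ip_commute[of square _ ?f])
  also have "\<dots> = (\<Sum>p\<in>{..1} \<times> {..1}. if p = (i, j) then weighted_ip Omega (mod_weight W r i j) f (g i j) else 0)"
    by (rule sum.cong[OF refl], subst weighted_ip_chi[OF f g ij]) (auto simp: ij)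
  also have "\<dots> = weighted_ip Omega (mod_weight W r i j) f (g i j)"
    using ij by (simp add: sum.delta)
  finally show ?thesis .
qed

lemma B_continuous: "i \<le> 1 \<Longrightarrow> j \<le> 1 \<Longrightarrow> k \<le> n \<Longrightarrow> continuous_on UNIV (B i j k n)"
  using B_onb[of i j n] continuous_below by (auto simp: onb_on_def orth_polys_iff)

text \<open>Such an \<open>f\<close> is itself one of the orthogonal polynomials of degree \<open>m - 1\<close>, so it is a combination of the
orthonormal basis there; its coefficients are inner products of \<open>f\<close> with polynomials of degree below
\<open>m\<close>. This is the form in
which definiteness of the inner product enters the proof.\<close>

lemma orthogonal_to_own_degree_imp_zero:
  assumes ij: "i \<le> 1" "j \<le> 1" and f: "f \<in> polys_below m"
    and orth: "\<And>g. g \<in> polys_below m \<Longrightarrow> weighted_ip Omega (mod_weight W r i j) f g = 0"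
  shows "f = (\<lambda>z. 0)"
proof (cases m)
  case 0
  then show ?thesis using f by (simp add: polys_below_0)
next
  case (Suc n)
  note onb = B_onb[OF ij, of n, unfolded onb_on_def]
  have "f \<in> orth_polys Omega (mod_weight W r i j) n"
    unfolding orth_polys_iff using f orth polys_below_mono[of _ n "Suc n"] Suc by auto
  then obtain c where c: "\<And>z. f z = (\<Sum>k\<le>n. c k * B i j k n z)"
    using onb by blast
  have "c l = 0" if "l \<le> n" for l
  proof -
    have "c l = weighted_ip Omega (mod_weight W r i j) (\<lambda>z. \<Sum>k\<le>n. c k * B i j k n z) (B i j l n)"
      by (rule weighted_ip_orthonormal_sum[OF bounded_Omega Omega_sets mod_weight_integrable, symmetric])
        (use onb B_continuous ij that in auto)
    also have "\<dots> = weighted_ip Omega (mod_weight W r i j) f (B i j l n)"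
      by (simp add: c[symmetric])
    also have "\<dots> = 0"
      using onb that by (intro orth) (auto simp: Suc orth_polys_iff)
    finally show ?thesis .
  qed
  then show ?thesis by (auto simp: c)
qed

text \<open>The factor \<open>sqrt (r i j)\<close> is grouped with \<open>B\<close>, so that \<open>weighted_ip_chi\<close> applies to the function as it
stands.\<close>

definition lifted :: "nat \<Rightarrow> (nat \<times> nat) \<times> nat \<Rightarrow> real \<times> real \<Rightarrow> real" where
  "lifted N = (\<lambda>((i, j), k) z. chi i j z * (sqrt (r i j) * B i j k ((N - i - j) div 2) (lift_map z)))"

lemma full_indexE:
  assumes "a \<in> full_index N"
  obtains i j k m where "a = ((i, j), k)" "i \<le> 1" "j \<le> 1" "N = i + j + 2 * m" "k \<le> m" "(N - i - j) div 2 = m"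
    "(i, j) \<in> parity_index N"
proof -
  obtain i j k where a: "a = ((i, j), k)" "(i, j) \<in> parity_index N" "k \<le> (N - i - j) div 2"
    using assms by (auto simp: full_index_def)
  then have "i \<le> 1" "j \<le> 1" "i + j \<le> N" "even (N - i - j)" by (auto simp: parity_index_def)
  then have "N = i + j + 2 * ((N - i - j) div 2)" by simp
  then show thesis using that a \<open>i \<le> 1\<close> \<open>j \<le> 1\<close> by blast
qed

lemma lifted_orthonormal:
  assumes "a \<in> full_index N" "b \<in> full_index N"
  shows "weighted_ip square (lift_weight W) (lifted N a) (lifted N b) = (if a = b then 1 else 0)"
proof -
  obtain i j k m where a: "a = ((i, j), k)" "i \<le> 1" "j \<le> 1" "N = i + j + 2 * m" "k \<le> m" "(N - i - j) div 2 = m"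
    using assms(1) by (rule full_indexE)
  obtain i' j' k' m' where b: "b = ((i', j'), k')" "i' \<le> 1" "j' \<le> 1" "N = i' + j' + 2 * m'" "k' \<le> m'"
      "(N - i' - j') div 2 = m'"
    using assms(2) by (rule full_indexE)
  have "r i j * weighted_ip square (lift_weight W) (lifted N a) (lifted N b) =
      (if i = i' \<and> j = j' then weighted_ip Omega (mod_weight W r i j) (\<lambda>z. sqrt (r i j) * B i j k m z)
        (\<lambda>z. sqrt (r i' j') * B i' j' k' m' z) else 0)"
    unfolding a(1) b(1) lifted_def prod.case a(6) b(6)
    by (rule weighted_ip_chi) (intro continuous_intros B_continuous a b)+
  also have "\<dots> = (if a = b then r i j else 0)"
  proof (cases "i = i' \<and> j = j'")
    case True
    then have "m' = m" using a(4) b(4) by simp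
    have "weighted_ip Omega (mod_weight W r i j) (\<lambda>z. sqrt (r i j) * B i j k m z) (\<lambda>z. sqrt (r i j) * B i j k' m z) =
        r i j * weighted_ip Omega (mod_weight W r i j) (B i j k m) (B i j k' m)"
      using r_pos[OF a(2,3)]
      by (simp add: weighted_ip_scale weighted_ip_commute[of _ _ _ "\<lambda>z. sqrt (r i j) * B i j k' m z"])
        (simp add: weighted_ip_commute)
    also have "\<dots> = (if k = k' then r i j else 0)"
      using B_onb[OF a(2,3), of m] a(5) b(5) \<open>m' = m\<close> by (simp add: onb_on_def)
    finally show ?thesis using True \<open>m' = m\<close> a(1) b(1) by auto
  qed (auto simp: a(1) b(1))
  finally show ?thesis using r_pos[OF a(2,3)] by (simp split: if_splits)
qed

lemma lifted_below:
  assumes "a \<in> full_index N"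
  shows "lifted N a \<in> polys_below (Suc N)"
proof -
  obtain i j k m where a: "a = ((i, j), k)" "i \<le> 1" "j \<le> 1" "N = i + j + 2 * m" "k \<le> m" "(N - i - j) div 2 = m"
    using assms by (rule full_indexE)
  have "B i j k m \<in> polys_below (Suc m)"
    using B_onb[OF a(2,3), of m] a(5) by (auto simp: onb_on_def orth_polys_iff)
  from polys_below_chi_compose_lift_map[OF polys_below_scale[OF this, of "sqrt (r i j)"], of i j]
  show ?thesis by (simp add: a(1) lifted_def a(6)) (simp add: a(4))
qed

text \<open>Only the component of \<open>Q\<close> in the parity class of \<open>lifted N a\<close> contributes, and for \<open>Q\<close> of degree
below \<open>N\<close> that component has degree below \<open>m\<close>.\<close>

lemma lifted_orth:
  assumes "a \<in> full_index N"
  shows "lifted N a \<in> orth_polys square (lift_weight W) N"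
  unfolding orth_polys_iff
proof (intro conjI ballI lifted_below assms)
  fix Q assume Q: "Q \<in> polys_below N"
  obtain i j k m where a: "a = ((i, j), k)" "i \<le> 1" "j \<le> 1" "N = i + j + 2 * m" "k \<le> m" "(N - i - j) div 2 = m"
    using assms by (rule full_indexE)
  obtain f where f: "\<forall>i\<le>1. \<forall>j\<le>1. f i j \<in> polys_below ((N + 1 - i - j) div 2)"
     "\<forall>z. Q z = (\<Sum>i\<le>1. \<Sum>j\<le>1. chi i j z * f i j (lift_map z))"
    using parity_split_below[OF Q] unfolding parity_split_def by blast
  have fc: "continuous_on UNIV (f i j)" if "i \<le> 1" "j \<le> 1" for i j
    using f(1) that continuous_below by blast
  have "r i j * weighted_ip square (lift_weight W) (lifted N a) Q =
      weighted_ip Omega (mod_weight W r i j) (\<lambda>z. sqrt (r i j) * B i j k m z) (f i j)"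
    unfolding a(1) lifted_def prod.case a(6)
    by (rule weighted_ip_parity_component[OF _ fc f(2)[rule_format] a(2,3)])
      (intro continuous_intros B_continuous a(2,3,5))
  also have "\<dots> = 0"
  proof -
    have "(N + 1 - i - j) div 2 = m" using a(4) by simp
    then have "f i j \<in> polys_below m" using f(1) a(2,3) by metis
    moreover have "B i j k m \<in> orth_polys Omega (mod_weight W r i j) m"
      using B_onb[OF a(2,3), of m] a(5) by (auto simp: onb_on_def)
    ultimately show ?thesis by (simp add: weighted_ip_scale orth_polys_iff)
  qed
  finally show "weighted_ip square (lift_weight W) (lifted N a) Q = 0"
    using r_pos[OF a(2,3)] by simp
qed

text \<open>Testing \<open>f\<close> against \<open>chi i j * (q \<circ> lift_map)\<close> of degree below \<open>N\<close> shows that each component of \<open>f\<close> is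
orthogonal to all such \<open>q\<close>. If \<open>N - i - j = 2 m\<close>, the component has degree at most \<open>m\<close> and \<open>q\<close> any degree
below \<open>m\<close>, so the component is an orthogonal polynomial. If \<open>N - i - j = 2 d + 1\<close>, the component and
\<open>q\<close> both range over degree at most \<open>d\<close>, so the component vanishes.\<close>

lemma lifted_span:
  assumes f: "f \<in> orth_polys square (lift_weight W) N"
  shows "\<exists>c. \<forall>z. f z = (\<Sum>a\<in>full_index N. c a * lifted N a z)"
proof -
  obtain g where g: "\<forall>i\<le>1. \<forall>j\<le>1. g i j \<in> polys_below ((Suc N + 1 - i - j) div 2)"
     "\<forall>z. f z = (\<Sum>i\<le>1. \<Sum>j\<le>1. chi i j z * g i j (lift_map z))"
    using parity_split_below[of f "Suc N"] f unfolding parity_split_def orth_polys_iff by blast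
  have gc: "continuous_on UNIV (g i j)" if "i \<le> 1" "j \<le> 1" for i j
    using g(1) that continuous_below by blast
  have orth: "weighted_ip Omega (mod_weight W r i j) (g i j) q = 0"
    if "i \<le> 1" "j \<le> 1" "q \<in> polys_below m" "i + j + 2 * m - 1 \<le> N" for i j q m
  proof -
    have "(\<lambda>z. chi i j z * q (lift_map z)) \<in> polys_below N"
      using polys_below_mono[OF polys_below_chi_compose_lift_map[OF that(3)] that(4)] .
    then have "weighted_ip square (lift_weight W) (\<lambda>z. chi i j z * q (lift_map z)) f = 0"
      using f weighted_ip_commute unfolding orth_polys_iff by metis
    moreover have "r i j * weighted_ip square (lift_weight W) (\<lambda>z. chi i j z * q (lift_map z)) f =
        weighted_ip Omega (mod_weight W r i j) q (g i j)"
      by (rule weighted_ip_parity_component[OF continuous_below[OF that(3)] gc g(2)[rule_format] that(1,2)])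
    ultimately show ?thesis by (simp add: weighted_ip_commute)
  qed
  have zero: "g i j = (\<lambda>z. 0)" if ij: "i \<le> 1" "j \<le> 1" "(i, j) \<notin> parity_index N" for i j
  proof (rule orthogonal_to_own_degree_imp_zero[OF ij(1,2)])
    let ?m = "(Suc N + 1 - i - j) div 2"
    show "g i j \<in> polys_below ?m" using g(1) ij by blast
    show "weighted_ip Omega (mod_weight W r i j) (g i j) q = 0" if q: "q \<in> polys_below ?m" for q
    proof (cases "i + j \<le> N")
      case True
      then have "odd (N - i - j)" using ij by (simp add: parity_index_def)
      then obtain d where "N - i - j = 2 * d + 1" by (rule oddE)
      then have N: "N = i + j + 2 * d + 1" using True by simp
      then have "?m = Suc d" by simp
      then show ?thesis using orth[OF ij(1,2) q] N by simp
    next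
      case False
      \<comment> \<open>Here \<open>chi i j\<close> alone has degree above \<open>N\<close>, and the component is zero for reasons of degree.\<close>
      then have "Suc N + 1 - i - j \<le> 1" by simp
      then have "?m = 0" by simp
      then show ?thesis using q by (simp only: polys_below_0) simp
    qed
  qed
  have "\<exists>c. \<forall>z. g i j z = (\<Sum>k\<le>(N - i - j) div 2. c k * B i j k ((N - i - j) div 2) z)"
    if "(i, j) \<in> parity_index N" for i j
  proof -
    let ?m = "(N - i - j) div 2"
    have ij: "i \<le> 1" "j \<le> 1" "i + j \<le> N" "even (N - i - j)" using that by (auto simp: parity_index_def)
    have N: "N = i + j + 2 * ?m" using ij by simp
    have "(Suc N + 1 - i - j) div 2 = Suc ?m" using ij(3) by simp
    then have "g i j \<in> polys_below (Suc ?m)" using g(1) ij(1,2) by metis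
    moreover have "\<forall>q\<in>polys_below ?m. weighted_ip Omega (mod_weight W r i j) (g i j) q = 0"
      using orth[OF ij(1,2), of _ ?m] N by simp
    ultimately have "g i j \<in> orth_polys Omega (mod_weight W r i j) ?m" by (simp add: orth_polys_iff)
    then show ?thesis using B_onb[OF ij(1,2), of ?m] by (simp add: onb_on_def)
  qed
  then obtain c where c: "\<And>i j z. (i, j) \<in> parity_index N \<Longrightarrow>
      g i j z = (\<Sum>k\<le>(N - i - j) div 2. c i j k * B i j k ((N - i - j) div 2) z)"
    by metis
  have "f z = (\<Sum>a\<in>full_index N. (case a of ((i, j), k) \<Rightarrow> c i j k / sqrt (r i j)) * lifted N a z)" for z
  proof -
    have "f z = (\<Sum>p\<in>{..1} \<times> {..1}. chi (fst p) (snd p) z * g (fst p) (snd p) (lift_map z))"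
      unfolding g(2)[rule_format] sum.cartesian_product
      by (simp add: case_prod_beta del: sum.atMost_Suc)
    also have "\<dots> = (\<Sum>p\<in>parity_index N. chi (fst p) (snd p) z * g (fst p) (snd p) (lift_map z))"
    proof (rule sum.mono_neutral_right)
      show "\<forall>p\<in>{..1} \<times> {..1} - parity_index N. chi (fst p) (snd p) z * g (fst p) (snd p) (lift_map z) = 0"
      proof
        fix p :: "nat \<times> nat" assume "p \<in> {..1} \<times> {..1} - parity_index N"
        then have "g (fst p) (snd p) = (\<lambda>z. 0)" by (intro zero) auto
        then show "chi (fst p) (snd p) z * g (fst p) (snd p) (lift_map z) = 0" by simp
      qed
    qed (auto simp: parity_index_def)
    also have "\<dots> = (\<Sum>p\<in>parity_index N. \<Sum>k\<in>(case p of (i, j) \<Rightarrow> {..(N - i - j) div 2}).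
        (case (p, k) of ((i, j), k) \<Rightarrow> c i j k / sqrt (r i j)) * lifted N (p, k) z)"
    proof (rule sum.cong[OF refl])
      fix p assume p: "p \<in> parity_index N"
      obtain i j where ij: "p = (i, j)" by fastforce
      have "r i j > 0" using p r_pos by (auto simp: ij parity_index_def)
      then show "chi (fst p) (snd p) z * g (fst p) (snd p) (lift_map z) =
          (\<Sum>k\<in>(case p of (i, j) \<Rightarrow> {..(N - i - j) div 2}).
        (case (p, k) of ((i, j), k) \<Rightarrow> c i j k / sqrt (r i j)) * lifted N (p, k) z)"
        using c[of i j "lift_map z"] p by (auto simp: ij lifted_def sum_distrib_left intro!: sum.cong)
    qed
    also have "\<dots> = (\<Sum>a\<in>full_index N. (case a of ((i, j), k) \<Rightarrow> c i j k / sqrt (r i j)) * lifted N a z)"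
      unfolding full_index_def
      by (subst sum.Sigma) (auto simp: finite_index intro!: sum.cong)
    finally show ?thesis .
  qed
  then show ?thesis by blast
qed

theorem lifted_onb:
  "onb_on (full_index N) (lifted N) square (lift_weight W) (orth_polys square (lift_weight W) N)"
  unfolding onb_on_def
proof (intro conjI ballI allI impI)
  fix c a assume c: "\<forall>z. (\<Sum>a\<in>full_index N. c a * lifted N a z) = 0" and a: "a \<in> full_index N"
  have "c a = weighted_ip square (lift_weight W) (\<lambda>z. \<Sum>a\<in>full_index N. c a * lifted N a z) (lifted N a)"
    by (rule weighted_ip_orthonormal_sum[OF bounded_square square_sets lift_weight_integrable, symmetric])
      (use lifted_orthonormal finite_full_index continuous_below[OF lifted_below] a in auto)
  then show "c a = 0" using c by simp
qed (use lifted_orth lifted_span lifted_orthonormal in auto)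

end

section \<open>The normalized weights built from a weight on the interval\<close>

lemma calW_eq_lift_weight: "calW w \<gamma> = lift_weight (W_weight w \<gamma>)"
  by (auto simp: calW_def lift_weight_def lift_map_def)

lemma set_lebesgue_integral_nonneg_if:
  assumes "\<And>z. z \<in> S \<Longrightarrow> 0 \<le> f z"
  shows "0 \<le> (LINT z:S|M. f z :: real)"
  unfolding set_lebesgue_integral_def
  by (rule integral_nonneg_AE) (use assms in \<open>auto simp: indicator_def\<close>)

lemma a_const_nonneg:
  assumes "\<forall>x\<in>{-1..1}. 0 \<le> w x"
  shows "0 \<le> a_const w \<gamma>"
  unfolding a_const_def
  by (intro divide_nonneg_nonneg set_lebesgue_integral_nonneg_if)
    (use assms in \<open>auto simp: energy_density_def\<close>)

lemma orth_polys_0_constant: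
  assumes "p \<in> orth_polys D W 0"
  shows "\<exists>c. \<forall>z. p z = c"
proof -
  have "p \<in> polys_below (Suc 0)" using assms by (simp add: orth_polys_iff)
  then obtain c :: "nat \<Rightarrow> nat \<Rightarrow> real" where
    "\<And>x y. p (x, y) = (\<Sum>(i, j)\<in>{(i, j). i + j < Suc 0}. c i j * x ^ i * y ^ j)"
    unfolding polys_below_def by blast
  moreover have "{(i, j). i + j < Suc 0} = {(0, 0)}" by auto
  ultimately show ?thesis by auto
qed

text \<open>The basis of degree zero is a single constant whose square has integral \<open>1\<close> against \<open>W\<close>. As the Lebesgue
integral of a function that is not integrable is \<open>0\<close>, integrability of \<open>W\<close> follows.\<close>

lemma weight_integrable_if_normalizable:
  assumes "onb_on {..0::nat} (\<lambda>k. B k) D W (orth_polys D W 0)"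
  shows "W absolutely_integrable_on D"
proof -
  have B: "B 0 \<in> orth_polys D W 0" "weighted_ip D W (B 0) (B 0) = 1"
    using assms by (auto simp: onb_on_def)
  obtain c where c: "\<forall>z. B 0 z = c" using orth_polys_0_constant[OF B(1)] by blast
  have *: "(LINT z:D|lebesgue. c * c * W z) = 1" using B(2) by (simp add: weighted_ip_def c)
  then have "c * c \<noteq> 0" by (auto simp: set_lebesgue_integral_def)
  moreover have "(\<lambda>z. c * c * W z) absolutely_integrable_on D"
    unfolding set_integrable_def
    using * not_integrable_integral_eq unfolding set_lebesgue_integral_def
    by (metis zero_neq_one)
  from set_integrable_mult_right[of "1 / (c * c)", OF this]
  have "(\<lambda>z. 1 / (c * c) * (c * c * W z)) absolutely_integrable_on D" .
  ultimately show ?thesis by simp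
qed

text \<open>For \<open>N = 2 n\<close> the classes of matching parity are \<open>(0, 0)\<close> and \<open>(1, 1)\<close>, where
\<open>chi 1 1 = x\<^sup>2 - y\<^sup>2\<close>; for \<open>N = 2 n + 1\<close> they are \<open>(0, 1)\<close> and \<open>(1, 0)\<close>. The unmodified weight is the
class \<open>(0, 0)\<close> with \<open>r 0 0 = 1\<close>.\<close>

theorem theorem4p3:
  fixes w :: "real \<Rightarrow> real" and \<gamma> :: real
    and P P11 P10 P01 :: "nat \<Rightarrow> nat \<Rightarrow> real \<times> real \<Rightarrow> real"
  assumes w_measurable: "w \<in> borel_measurable (lebesgue_on {-1..1})"
    and w_nonneg: "\<forall>x\<in>{-1..1}. 0 \<le> w x"
    and gamma: "\<gamma> > -1"
    and finite_integral: "set_integrable lebesgue square (energy_density w \<gamma>)"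
    and pos_integral: "0 < (LINT z:square|lebesgue. energy_density w \<gamma> z)"
    and P: "\<forall>n. onb_on {..n} (\<lambda>k. P k n) Omega (W_weight w \<gamma>)
              (orth_polys Omega (W_weight w \<gamma>) n)"
    and P11: "\<forall>n. onb_on {..n} (\<lambda>k. P11 k n) Omega (W_mod w \<gamma> 1 1)
              (orth_polys Omega (W_mod w \<gamma> 1 1) n)"
    and P10: "\<forall>n. onb_on {..n} (\<lambda>k. P10 k n) Omega (W_mod w \<gamma> 1 0)
              (orth_polys Omega (W_mod w \<gamma> 1 0) n)"
    and P01: "\<forall>n. onb_on {..n} (\<lambda>k. P01 k n) Omega (W_mod w \<gamma> 0 1)
              (orth_polys Omega (W_mod w \<gamma> 0 1) n)"
  shows "\<forall>n.
    onb_on ({..n} <+> {..<n})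
      (case_sum
        (\<lambda>k (x, y). P k n (2 * x * y, x\<^sup>2 + y\<^sup>2 - 1))
        (\<lambda>k (x, y). b_const w \<gamma> 1 1 * (x\<^sup>2 - y\<^sup>2)
                      * P11 k (n - 1) (2 * x * y, x\<^sup>2 + y\<^sup>2 - 1)))
      square (calW w \<gamma>) (orth_polys square (calW w \<gamma>) (2 * n)) \<and>
    onb_on ({..n} <+> {..n})
      (case_sum
        (\<lambda>k (x, y). b_const w \<gamma> 0 1 * (x + y)
                      * P01 k n (2 * x * y, x\<^sup>2 + y\<^sup>2 - 1))
        (\<lambda>k (x, y). b_const w \<gamma> 1 0 * (x - y)
                      * P10 k n (2 * x * y, x\<^sup>2 + y\<^sup>2 - 1)))
      square (calW w \<gamma>) (orth_polys square (calW w \<gamma>) (2 * n + 1))"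
proof -
  define r where "r i j = a_const (w_mod w i j) \<gamma> / a_const w \<gamma>" for i j
  define B where "B i j = (if i = 0 then if j = 0 then P else P01 else if j = 0 then P10 else P11)"
    for i j :: nat
  have a: "a_const w \<gamma> > 0" using pos_integral by (simp add: a_const_def)
  have w_mod_00: "w_mod w 0 0 = w" by (simp add: w_mod_def)
  have W_mod: "W_mod w \<gamma> i j = mod_weight (W_weight w \<gamma>) r i j" for i j
    by (auto simp: W_mod_def mod_weight_def r_def)
  have W_mod_00: "W_mod w \<gamma> 0 0 = W_weight w \<gamma>"
    using a by (auto simp: W_mod_def w_mod_00)
  have B: "onb_on {..n} (\<lambda>k. B i j k n) Omega (W_mod w \<gamma> i j) (orth_polys Omega (W_mod w \<gamma> i j) n)"
    if "i \<le> 1" "j \<le> 1" for i j n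
  proof -
    have "i = 0 \<or> i = 1" "j = 0 \<or> j = 1" using that by auto
    then show ?thesis using P P11 P10 P01 by (elim disjE) (simp_all add: B_def W_mod_00 flip: One_nat_def)
  qed
  have r_pos: "r i j > 0" if "i \<le> 1" "j \<le> 1" for i j
  proof -
    have "0 \<le> r i j"
      unfolding r_def using a w_nonneg
      by (intro divide_nonneg_pos a_const_nonneg) (auto simp: w_mod_def)
    \<comment> \<open>If this constant were zero, the weight would vanish and no polynomial could have norm one.\<close>
    moreover have "r i j \<noteq> 0"
    proof
      assume "r i j = 0"
      then have "W_mod w \<gamma> i j = (\<lambda>z. 0)" by (simp add: W_mod mod_weight_def)
      then have "weighted_ip Omega (W_mod w \<gamma> i j) (B i j 0 0) (B i j 0 0) = 0"
        by (simp add: weighted_ip_def set_lebesgue_integral_def)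
      then show False using B[OF that, of 0] by (simp add: onb_on_def)
    qed
    ultimately show ?thesis by simp
  qed
  interpret lifted_bases "W_weight w \<gamma>" r B
  proof
    show "W_weight w \<gamma> absolutely_integrable_on Omega"
      by (rule weight_integrable_if_normalizable[OF P[rule_format, of 0]])
  qed (use r_pos B W_mod in auto)
  have r00: "r 0 0 = 1" using a by (simp add: r_def w_mod_00)
  have b: "b_const w \<gamma> i j = sqrt (r i j)" for i j by (simp add: b_const_def r_def)
  show ?thesis
    unfolding calW_eq_lift_weight
  proof (intro allI conjI)
    fix n
    let ?h = "case_sum (\<lambda>k. ((0, 0), k)) (\<lambda>k. ((1, 1), k)) :: nat + nat \<Rightarrow> (nat \<times> nat) \<times> nat"
    have "bij_betw ?h ({..n} <+> {..<n}) (full_index (2 * n))"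
      by (intro bij_betw_imageI) (auto simp: inj_on_def full_index_even Plus_def image_Un image_image simp del: One_nat_def)
    from onb_on_reindex[OF this lifted_onb]
    show "onb_on ({..n} <+> {..<n})
      (case_sum
        (\<lambda>k (x, y). P k n (2 * x * y, x\<^sup>2 + y\<^sup>2 - 1))
        (\<lambda>k (x, y). b_const w \<gamma> 1 1 * (x\<^sup>2 - y\<^sup>2)
                      * P11 k (n - 1) (2 * x * y, x\<^sup>2 + y\<^sup>2 - 1)))
      square (lift_weight (W_weight w \<gamma>)) (orth_polys square (lift_weight (W_weight w \<gamma>)) (2 * n))"
    proof (rule back_subst[of "\<lambda>F. onb_on _ F _ _ _"])
      show "(\<lambda>s. lifted (2 * n) (?h s)) = case_sum
        (\<lambda>k (x, y). P k n (2 * x * y, x\<^sup>2 + y\<^sup>2 - 1))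
        (\<lambda>k (x, y). b_const w \<gamma> 1 1 * (x\<^sup>2 - y\<^sup>2)
                      * P11 k (n - 1) (2 * x * y, x\<^sup>2 + y\<^sup>2 - 1))"
      proof
        fix s :: "nat + nat"
        have "(x - y) * (x + y) = x\<^sup>2 - y\<^sup>2" for x y :: real
          by (simp add: power2_eq_square algebra_simps)
        moreover have "(2 * n - 1 - 1) div 2 = n - 1" by simp
        ultimately show "lifted (2 * n) (?h s) = case_sum
          (\<lambda>k (x, y). P k n (2 * x * y, x\<^sup>2 + y\<^sup>2 - 1))
          (\<lambda>k (x, y). b_const w \<gamma> 1 1 * (x\<^sup>2 - y\<^sup>2)
                        * P11 k (n - 1) (2 * x * y, x\<^sup>2 + y\<^sup>2 - 1)) s"
          by (cases s) (simp_all add: fun_eq_iff lifted_def chi_def lift_map_def B_def r00 b del: One_nat_def)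
      qed
    qed
  next
    fix n
    let ?h = "case_sum (\<lambda>k. ((0, 1), k)) (\<lambda>k. ((1, 0), k)) :: nat + nat \<Rightarrow> (nat \<times> nat) \<times> nat"
    have "bij_betw ?h ({..n} <+> {..n}) (full_index (2 * n + 1))"
      by (intro bij_betw_imageI) (auto simp: inj_on_def full_index_odd Plus_def image_Un image_image simp del: One_nat_def)
    from onb_on_reindex[OF this lifted_onb]
    show "onb_on ({..n} <+> {..n})
      (case_sum
        (\<lambda>k (x, y). b_const w \<gamma> 0 1 * (x + y)
                      * P01 k n (2 * x * y, x\<^sup>2 + y\<^sup>2 - 1))
        (\<lambda>k (x, y). b_const w \<gamma> 1 0 * (x - y)
                      * P10 k n (2 * x * y, x\<^sup>2 + y\<^sup>2 - 1)))
      square (lift_weight (W_weight w \<gamma>)) (orth_polys square (lift_weight (W_weight w \<gamma>)) (2 * n + 1))"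
    proof (rule back_subst[of "\<lambda>F. onb_on _ F _ _ _"])
      show "(\<lambda>s. lifted (2 * n + 1) (?h s)) = case_sum
        (\<lambda>k (x, y). b_const w \<gamma> 0 1 * (x + y)
                      * P01 k n (2 * x * y, x\<^sup>2 + y\<^sup>2 - 1))
        (\<lambda>k (x, y). b_const w \<gamma> 1 0 * (x - y)
                      * P10 k n (2 * x * y, x\<^sup>2 + y\<^sup>2 - 1))"
      proof
        fix s :: "nat + nat"
        show "lifted (2 * n + 1) (?h s) = case_sum
          (\<lambda>k (x, y). b_const w \<gamma> 0 1 * (x + y)
                        * P01 k n (2 * x * y, x\<^sup>2 + y\<^sup>2 - 1))
          (\<lambda>k (x, y). b_const w \<gamma> 1 0 * (x - y)
                        * P10 k n (2 * x * y, x\<^sup>2 + y\<^sup>2 - 1)) s"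
          by (cases s) (simp_all add: fun_eq_iff lifted_def chi_def lift_map_def B_def b del: One_nat_def)
      qed
    qed
  qed
qed

end
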